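(* Let $U$ be a graphon. Then from the Turing jump of any $d_\square$-name of $U$ we can compute a $d_1$-name of $U$. In particular, if $U$ has a computable $d_\square$-name, then it has a $0'$-computable $d_1$-name.
   Context: A graphon is a symmetric measurable function $W\colon[0,1]^2\to[0,1]$. For symmetric measurable $F\colon[0,1]^2\to[-1,1]$, $\|F\|_\square=\sup_{S,T\subseteq[0,1]}\left|\int_{S\times T}F(x,y)\,dx\,dy\right|$ (over measurable $S,T$) and $\|F\|_1=\int|F(x,y)|\,dx\,dy$. For graphons $U,W$: $d_\square(U,W)=\|U-W\|_\square$ and $d_1(U,W)=\|U-W\|_1$. Let $\mathcal{S}=(s_i)_{i\in\mathbb{N}}$ be a (straightforward) computable enumeration of the graphons that are constant with a rational value on each product $p\times q$ of parts $p,q$ of a partition of $[0,1]$ into finitely many equally-sized intervals. For $d\in\{d_1,d_\square\}$, a $d$-name of a graphon $U$ is a sequence $(s_{k_j})_{j\in\mathbb{N}}$ of elements of $\mathcal{S}$ with $d(s_{k_j},s_{k_\ell})\le2^{-j}$ for all $j<\ell$ and $d(s_{k_j},U)\to0$. Such a name is identified with its index sequence $(k_j)_{j}$; it is computable (or computable from an oracle) if $(k_j)_j$ is. $0'$ is the halting set. *)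

theory Defs
  imports "HOL-Analysis.Analysis" "HOL-Library.Nat_Bijection"
begin

section \<open>Oracle computability\<close>

text \<open>
  Kleene's partial recursive functions relative to an oracle \<open>f :: nat \<Rightarrow> nat\<close>, as programs with one
  input and one output; several arguments are passed as Cantor pairs. A set oracle is given by its
  characteristic function.
\<close>

datatype prog =
    Zero | Succ | Fst | Snd | Query
  | Pair prog prog | Comp prog prog | Prec prog prog | Mu prog

abbreviation cpair :: "nat \<Rightarrow> nat \<Rightarrow> nat" where
  "cpair m n \<equiv> prod_encode (m, n)"

inductive evaluates :: "(nat \<Rightarrow> nat) \<Rightarrow> prog \<Rightarrow> nat \<Rightarrow> nat \<Rightarrow> bool" for f where
  Zero: "evaluates f Zero x 0"
| Succ: "evaluates f Succ x (Suc x)"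
| Fst: "evaluates f Fst (cpair x y) x"
| Snd: "evaluates f Snd (cpair x y) y"
| Query: "evaluates f Query x (f x)"
| Pair: "evaluates f p x y \<Longrightarrow> evaluates f q x z \<Longrightarrow> evaluates f (Pair p q) x (cpair y z)"
| Comp: "evaluates f q x y \<Longrightarrow> evaluates f p y z \<Longrightarrow> evaluates f (Comp p q) x z"
| Prec_0: "evaluates f p x y \<Longrightarrow> evaluates f (Prec p q) (cpair x 0) y"
| Prec_Suc: "evaluates f (Prec p q) (cpair x n) y \<Longrightarrow> evaluates f q (cpair x (cpair n y)) z
    \<Longrightarrow> evaluates f (Prec p q) (cpair x (Suc n)) z"
| Mu: "evaluates f p (cpair x n) 0 \<Longrightarrow> (\<forall>m<n. \<exists>y>0. evaluates f p (cpair x m) y)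
    \<Longrightarrow> evaluates f (Mu p) x n"

definition computable_from :: "(nat \<Rightarrow> nat) \<Rightarrow> (nat \<Rightarrow> nat) \<Rightarrow> bool" where
  "computable_from f g \<longleftrightarrow> (\<exists>p. \<forall>x. evaluates f p x (g x))"

definition computable :: "(nat \<Rightarrow> nat) \<Rightarrow> bool" where
  "computable g \<longleftrightarrow> computable_from (indicator {}) g"

text \<open>A Goedel numbering of the programs.\<close>

primrec code :: "prog \<Rightarrow> nat" where
  "code Zero = cpair 0 0"
| "code Succ = cpair 1 0"
| "code Fst = cpair 2 0"
| "code Snd = cpair 3 0"
| "code Query = cpair 4 0"
| "code (Pair p q) = cpair 5 (cpair (code p) (code q))"
| "code (Comp p q) = cpair 6 (cpair (code p) (code q))"
| "code (Prec p q) = cpair 7 (cpair (code p) (code q))"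
| "code (Mu p) = cpair 8 (code p)"

definition jump :: "(nat \<Rightarrow> nat) \<Rightarrow> nat set" where
  "jump f = {code p | p. \<exists>y. evaluates f p (code p) y}"

definition halting_set :: "nat set" where
  "halting_set = jump (indicator {})"

lemma code_inject: "code p = code q \<Longrightarrow> p = q"
proof (induction p arbitrary: q)
  case Zero then show ?case by (cases q) auto
next
  case Succ then show ?case by (cases q) auto
next
  case Fst then show ?case by (cases q) auto
next
  case Snd then show ?case by (cases q) auto
next
  case Query then show ?case by (cases q) auto
next
  case (Pair p1 p2) then show ?case by (cases q) auto
next
  case (Comp p1 p2) then show ?case by (cases q) auto
next
  case (Prec p1 p2) then show ?case by (cases q) auto
next
  case (Mu p) then show ?case by (cases q) auto
qed

inductive_cases evaluates_cases:
  "evaluates f Zero x y" "evaluates f Succ x y" "evaluates f Fst x y" "evaluates f Snd x y"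
  "evaluates f Query x y" "evaluates f (Pair p q) x y" "evaluates f (Comp p q) x y"
  "evaluates f (Prec p q) x y" "evaluates f (Mu p) x y"

lemma evaluates_unique: "evaluates f p x y \<Longrightarrow> evaluates f p x z \<Longrightarrow> y = z"
proof (induction arbitrary: z rule: evaluates.induct)
  case (Pair p x y q z w)
  from Pair.prems obtain y' z' where "w = cpair y' z'" "evaluates f p x y'" "evaluates f q x z'"
    by (rule evaluates_cases(6))
  then show ?case using Pair.IH by simp
next
  case (Comp q x y p z w)
  from Comp.prems obtain y' where "evaluates f q x y'" "evaluates f p y' w"
    by (rule evaluates_cases(7))
  then show ?case using Comp.IH by simp
next
  case (Prec_0 p x y q w)
  from Prec_0.prems show ?case
    by (rule evaluates_cases(8)) (use Prec_0.IH in auto)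
next
  case (Prec_Suc p q x n y z w)
  from Prec_Suc.prems show ?case
  proof (rule evaluates_cases(8))
    fix x' n' y' assume "cpair x (Suc n) = cpair x' (Suc n')"
      "evaluates f (Prec p q) (cpair x' n') y'" "evaluates f q (cpair x' (cpair n' y')) w"
    then show ?thesis using Prec_Suc.IH by simp
  qed simp
next
  case (Mu p x n w)
  from Mu.prems have w: "evaluates f p (cpair x w) 0" "\<forall>m<w. \<exists>y>0. evaluates f p (cpair x m) y"
    by (auto elim: evaluates_cases(9))
  show ?case
  proof (cases n w rule: linorder_cases)
    case less
    then obtain y where "y > 0" "evaluates f p (cpair x n) y" using w(2) by blast
    then show ?thesis using Mu.IH(1)[of y] by simp
  next
    case greater
    then show ?thesis using w(1) Mu.IH(2) by fastforce
  qed
qed (erule evaluates_cases, simp)+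

section \<open>Graphons\<close>

abbreviation unit_square :: "(real \<times> real) set" where
  "unit_square \<equiv> {0..1} \<times> {0..1}"

text \<open>Only the values on the unit square matter, here and in the distances below.\<close>

definition graphon :: "(real \<times> real \<Rightarrow> real) \<Rightarrow> bool" where
  "graphon W \<longleftrightarrow> W \<in> borel_measurable (lebesgue_on unit_square) \<and>
     (\<forall>x\<in>{0..1}. \<forall>y\<in>{0..1}. W (x, y) = W (y, x) \<and> 0 \<le> W (x, y) \<and> W (x, y) \<le> 1)"

definition cut_norm :: "(real \<times> real \<Rightarrow> real) \<Rightarrow> real" where
  "cut_norm F = (SUP (S, T) \<in> {S \<in> sets lebesgue. S \<subseteq> {0..1}} \<times> {T \<in> sets lebesgue. T \<subseteq> {0..1}}.
     \<bar>LINT p:S \<times> T|lebesgue. F p\<bar>)"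

definition L1_norm :: "(real \<times> real \<Rightarrow> real) \<Rightarrow> real" where
  "L1_norm F = (LINT p:unit_square|lebesgue. \<bar>F p\<bar>)"

definition cut_dist :: "(real \<times> real \<Rightarrow> real) \<Rightarrow> (real \<times> real \<Rightarrow> real) \<Rightarrow> real" where
  "cut_dist U W = cut_norm (\<lambda>p. U p - W p)"

definition L1_dist :: "(real \<times> real \<Rightarrow> real) \<Rightarrow> (real \<times> real \<Rightarrow> real) \<Rightarrow> real" where
  "L1_dist U W = L1_norm (\<lambda>p. U p - W p)"

section \<open>Rational step graphons and names\<close>

text \<open>
  The \<open>i\<close>-th part of the partition of \<open>[0,1]\<close> into \<open>n\<close> intervals of length \<open>1/n\<close>: half-open
  intervals, except that the last one is closed.
\<close>

definition part :: "nat \<Rightarrow> nat \<Rightarrow> real set" where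
  "part n i = (if Suc i = n then {real i / real n..1}
               else {real i / real n..<real (Suc i) / real n})"

definition step_graphon :: "(real \<times> real \<Rightarrow> real) \<Rightarrow> bool" where
  "step_graphon W \<longleftrightarrow> graphon W \<and>
     (\<exists>n>0. \<forall>i<n. \<forall>j<n. \<exists>q\<in>\<rat>. \<forall>x\<in>part n i. \<forall>y\<in>part n j. W (x, y) = q)"

text \<open>
  An enumeration of the rational step graphons (up to values outside the unit square) from whose
  indices the number \<open>N k\<close> of intervals and the rational value \<open>a / (b + 1)\<close> on each product of
  two parts can be computed.
\<close>

definition computable_enumeration :: "(nat \<Rightarrow> real \<times> real \<Rightarrow> real) \<Rightarrow> bool" where
  "computable_enumeration s \<longleftrightarrow>
     (\<forall>k. step_graphon (s k)) \<and>
     (\<forall>W. step_graphon W \<longrightarrow> (\<exists>k. \<forall>p\<in>unit_square. s k p = W p)) \<and>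
     (\<exists>N a b. computable N \<and> computable a \<and> computable b \<and>
        (\<forall>k. N k > 0 \<and>
           (\<forall>i<N k. \<forall>j<N k. \<forall>x\<in>part (N k) i. \<forall>y\<in>part (N k) j.
              s k (x, y) = real (a (cpair k (cpair i j))) / real (Suc (b (cpair k (cpair i j)))))))"

definition is_name ::
  "((real \<times> real \<Rightarrow> real) \<Rightarrow> (real \<times> real \<Rightarrow> real) \<Rightarrow> real) \<Rightarrow> (nat \<Rightarrow> real \<times> real \<Rightarrow> real) \<Rightarrow>
   (real \<times> real \<Rightarrow> real) \<Rightarrow> (nat \<Rightarrow> nat) \<Rightarrow> bool" where
  "is_name d s U k \<longleftrightarrow>
     (\<forall>j l. j < l \<longrightarrow> d (s (k j)) (s (k l)) \<le> 1 / 2 ^ j) \<and>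
     (\<lambda>j. d (s (k j)) U) \<longlonglongrightarrow> 0"

section \<open>Existence of a computable enumeration\<close>

lemma computable_from_fst: "computable_from f (\<lambda>x. fst (prod_decode x))"
  unfolding computable_from_def
  by (rule exI[of _ Fst]) (metis evaluates.Fst prod_decode_inverse surjective_pairing)

lemma computable_from_snd: "computable_from f (\<lambda>x. snd (prod_decode x))"
  unfolding computable_from_def
  by (rule exI[of _ Snd]) (metis evaluates.Snd prod_decode_inverse surjective_pairing)

lemma computable_from_pair:
  "computable_from f g \<Longrightarrow> computable_from f h \<Longrightarrow> computable_from f (\<lambda>x. cpair (g x) (h x))"
  unfolding computable_from_def by (blast intro: evaluates.Pair)

lemma computable_from_comp:
  "computable_from f g \<Longrightarrow> computable_from f h \<Longrightarrow> computable_from f (\<lambda>x. g (h x))"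
  unfolding computable_from_def by (blast intro: evaluates.Comp)

lemma computable_from_id: "computable_from f (\<lambda>x. x)"
  using computable_from_pair[OF computable_from_fst computable_from_snd] by simp

lemma computable_from_Suc: "computable_from f g \<Longrightarrow> computable_from f (\<lambda>x. Suc (g x))"
  by (rule computable_from_comp[of _ Suc])
    (auto simp: computable_from_def intro: evaluates.Succ)

lemma computable_from_rec:
  assumes g: "computable_from f g" and h: "computable_from f h" and t: "computable_from f t"
  shows "computable_from f (\<lambda>x. rec_nat (g x) (\<lambda>n r. h (cpair x (cpair n r))) (t x))"
proof -
  obtain p q where p: "\<And>x. evaluates f p x (g x)" and q: "\<And>x. evaluates f q x (h x)"
    using g h unfolding computable_from_def by blast
  have *: "evaluates f (Prec p q) (cpair x m) (rec_nat (g x) (\<lambda>n r. h (cpair x (cpair n r))) m)"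
    for x m
    by (induction m) (auto intro: evaluates.intros p q)
  have "computable_from f (\<lambda>z. case prod_decode z of
      (x, m) \<Rightarrow> rec_nat (g x) (\<lambda>n r. h (cpair x (cpair n r))) m)"
    unfolding computable_from_def
  proof (intro exI allI)
    fix z show "evaluates f (Prec p q) z (case prod_decode z of
      (x, m) \<Rightarrow> rec_nat (g x) (\<lambda>n r. h (cpair x (cpair n r))) m)"
      using *[of "fst (prod_decode z)" "snd (prod_decode z)"] by (simp add: case_prod_beta)
  qed
  from computable_from_comp[OF this computable_from_pair[OF computable_from_id t]]
  show ?thesis by simp
qed

lemma computable_from_diff:
  assumes g: "computable_from f g" and h: "computable_from f h"
  shows "computable_from f (\<lambda>x. g x - h x)"
proof -
  note I = computable_from_comp[OF computable_from_fst] computable_from_comp[OF computable_from_snd]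
    computable_from_id
  have Z: "computable_from f (\<lambda>x. 0)"
    by (auto simp: computable_from_def intro: evaluates.Zero)
  have "computable_from f (\<lambda>x. rec_nat 0 (\<lambda>n r. fst (prod_decode (snd (prod_decode (cpair x (cpair n r)))))) x)"
    by (rule computable_from_rec[where h = "\<lambda>z. fst (prod_decode (snd (prod_decode z)))"])
      (intro I Z)+
  moreover have "rec_nat 0 (\<lambda>n r. n) x = x - 1" for x :: nat
    by (cases x) auto
  ultimately have P: "computable_from f (\<lambda>x. x - 1)" by simp
  have "computable_from f (\<lambda>x. rec_nat (g x) (\<lambda>n r. snd (prod_decode (snd (prod_decode (cpair x (cpair n r))))) - 1) (h x))"
    by (rule computable_from_rec[where h = "\<lambda>z. snd (prod_decode (snd (prod_decode z))) - 1"])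
      (intro g h I computable_from_comp[OF P])+
  moreover have "rec_nat a (\<lambda>n r. r - 1) b = a - b" for a b :: nat
    by (induction b) auto
  ultimately show ?thesis by simp
qed

lemma computable_from_add:
  assumes g: "computable_from f g" and h: "computable_from f h"
  shows "computable_from f (\<lambda>x. g x + h x)"
proof -
  note I = computable_from_comp[OF computable_from_fst] computable_from_comp[OF computable_from_snd]
    computable_from_id
  have "computable_from f (\<lambda>x. rec_nat (g x) (\<lambda>n r. Suc (snd (prod_decode (snd (prod_decode (cpair x (cpair n r))))))) (h x))"
    by (rule computable_from_rec[where h = "\<lambda>z. Suc (snd (prod_decode (snd (prod_decode z))))"])
      (intro g h I computable_from_Suc)+
  moreover have "rec_nat a (\<lambda>n r. Suc r) b = a + b" for a b :: nat
    by (induction b) auto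
  ultimately show ?thesis by simp
qed

definition table :: "nat \<Rightarrow> nat \<Rightarrow> nat" where
  "table m p = fst (prod_decode (rec_nat m (\<lambda>_ r. snd (prod_decode r)) p))"

lemma ex_table: "\<exists>m. \<forall>p<P. table m p = v p"
proof (induction P arbitrary: v)
  case (Suc P)
  obtain m where m: "\<forall>p<P. table m p = v (Suc p)"
    using Suc[of "\<lambda>p. v (Suc p)"] by blast
  have "rec_nat (cpair (v 0) m) (\<lambda>_ r. snd (prod_decode r)) (Suc p)
      = rec_nat m (\<lambda>_ r. snd (prod_decode r)) p" for p
    by (induction p) auto
  then have "table (cpair (v 0) m) (Suc p) = table m p" for p
    unfolding table_def by simp
  moreover have "table (cpair (v 0) m) 0 = v 0"
    by (simp add: table_def)
  ultimately have "\<forall>p<Suc P. table (cpair (v 0) m) p = v p"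
    using m by (metis Suc_less_eq less_Suc_eq_0_disj)
  then show ?case ..
qed simp

lemma computable_from_table:
  assumes g: "computable_from f g" and h: "computable_from f h"
  shows "computable_from f (\<lambda>x. table (g x) (h x))"
proof -
  note I = computable_from_comp[OF computable_from_fst] computable_from_comp[OF computable_from_snd]
    computable_from_id
  have "computable_from f (\<lambda>x. rec_nat (g x) (\<lambda>n r. snd (prod_decode (snd (prod_decode (snd (prod_decode (cpair x (cpair n r)))))))) (h x))"
    by (rule computable_from_rec[where h = "\<lambda>z. snd (prod_decode (snd (prod_decode (snd (prod_decode z)))))"])
      (intro g h I)+
  then have "computable_from f (\<lambda>x. rec_nat (g x) (\<lambda>n r. snd (prod_decode r)) (h x))"
    by simp
  then show ?thesis unfolding table_def by (rule I)
qed

definition part_index :: "nat \<Rightarrow> real \<Rightarrow> nat" where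
  "part_index n x = min n (nat \<lfloor>real (Suc n) * x\<rfloor>)"

lemma part_subset: "i < n \<Longrightarrow> part n i \<subseteq> {0..1}"
proof
  fix x assume i: "i < n" and "x \<in> part n i"
  then have "real i / real n \<le> x" "x \<le> 1 \<or> x < real (Suc i) / real n"
    by (auto simp: part_def split: if_splits)
  moreover have "0 \<le> real i / real n" "real (Suc i) / real n \<le> 1"
    using i by (auto simp del: of_nat_Suc)
  ultimately show "x \<in> {0..1}" unfolding atLeastAtMost_iff by linarith
qed

lemma part_nonempty: "i < n \<Longrightarrow> real i / real n \<in> part n i"
  by (auto simp: part_def field_simps)

lemma part_index_part: "i < Suc n \<Longrightarrow> x \<in> part (Suc n) i \<Longrightarrow> part_index n x = i"
proof -
  assume i: "i < Suc n" and x: "x \<in> part (Suc n) i"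
  have lo: "real i \<le> real (Suc n) * x"
    using x by (auto simp: part_def field_simps split: if_splits)
  show ?thesis
  proof (cases "i = n")
    case True
    then show ?thesis using lo by (auto simp: part_index_def min_def le_nat_floor)
  next
    case False
    then have "real (Suc n) * x < real (Suc i)"
      using x by (auto simp: part_def field_simps)
    then have "\<lfloor>real (Suc n) * x\<rfloor> = int i" using lo by (intro floor_unique) auto
    then show ?thesis using i by (simp add: part_index_def)
  qed
qed

lemma part_index_less: "part_index n x < Suc n"
  by (simp add: part_index_def)

lemma mem_part_index: "x \<in> {0..1} \<Longrightarrow> x \<in> part (Suc n) (part_index n x)"
proof -
  assume x: "x \<in> {0..1}"
  have nn: "real (nat \<lfloor>real (Suc n) * x\<rfloor>) = of_int \<lfloor>real (Suc n) * x\<rfloor>"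
    using x by simp
  show ?thesis
  proof (cases "nat \<lfloor>real (Suc n) * x\<rfloor> < n")
    case True
    then have e: "part_index n x = nat \<lfloor>real (Suc n) * x\<rfloor>" by (simp add: part_index_def)
    have "real (part_index n x) \<le> real (Suc n) * x"
      unfolding e nn by (rule of_int_floor_le)
    moreover have "real (Suc n) * x < real (Suc (part_index n x))"
      unfolding e using real_of_int_floor_add_one_gt[of "real (Suc n) * x"] nn by linarith
    ultimately show ?thesis using True e x by (auto simp: part_def field_simps)
  next
    case False
    then have e: "part_index n x = n" by (simp add: part_index_def)
    have "real n \<le> real (nat \<lfloor>real (Suc n) * x\<rfloor>)" using False by simp
    also have "\<dots> \<le> real (Suc n) * x" unfolding nn by (rule of_int_floor_le)
    finally show ?thesis using x e by (auto simp: part_def field_simps)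
  qed
qed

lemma ex_common_denominator:
  "finite Q \<Longrightarrow> Q \<subseteq> \<rat> \<Longrightarrow> \<exists>d. \<forall>q\<in>Q. q * real (Suc d) \<in> \<int>"
proof (induction Q rule: finite_induct)
  case (insert q Q)
  then obtain d where d: "\<forall>q\<in>Q. q * real (Suc d) \<in> \<int>" by auto
  from insert.prems obtain a :: int and b :: nat where ab: "b > 0" "q = a / real b"
    by (auto elim!: Rats_cases' simp: of_nat_nat) (metis nat_0_less_mult_iff of_int_of_nat_eq zero_less_imp_eq_int of_nat_0_less_iff)
  obtain e where e: "Suc e = b * Suc d" using ab(1) by (metis gr0_implies_Suc nat_0_less_mult_iff zero_less_Suc)
  have "q * real (Suc e) = of_int (a * int (Suc d))" unfolding e ab(2) using ab(1) by (simp add: field_simps)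
  moreover have "r * real (Suc e) \<in> \<int>" if "r \<in> Q" for r
  proof -
    have "r * real (Suc e) = (r * real (Suc d)) * of_nat b" unfolding e by (simp add: algebra_simps)
    then show ?thesis using d that by (metis Ints_mult Ints_of_nat)
  qed
  ultimately show ?case by (metis Ints_of_int insertE)
qed simp

lemma ex_computable_enumeration: "\<exists>s. computable_enumeration s"
proof -
  define N where "N k = Suc (fst (prod_decode k))" for k
  define D where "D k = fst (prod_decode (snd (prod_decode k)))" for k
  define M where "M k = snd (prod_decode (snd (prod_decode k)))" for k
  define mi where "mi i j = i - (i - j)" for i j :: nat
  define ma where "ma i j = i + (j - i)" for i j :: nat
  define v where "v k i j = mi (Suc (D k)) (table (M k) (cpair (mi i j) (ma i j)))" for k i j
  define s where "s k p = (if p \<in> unit_square then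
    real (v k (part_index (fst (prod_decode k)) (fst p)) (part_index (fst (prod_decode k)) (snd p)))
      / real (Suc (D k)) else 0)" for k and p :: "real \<times> real"
  have mi: "mi i j = min i j" and ma: "ma i j = max i j" for i j
    by (auto simp: mi_def ma_def)
  have v_sym: "v k i j = v k j i" for k i j
    by (simp add: v_def mi ma min.commute max.commute)
  have v_le: "v k i j \<le> Suc (D k)" for k i j
    by (simp add: v_def mi)
  have s_val: "s k (x, y) = real (v k i j) / real (Suc (D k))"
    if "i < N k" "j < N k" "x \<in> part (N k) i" "y \<in> part (N k) j" for k i j x y
    using that part_subset[of i "N k"] part_subset[of j "N k"]
    by (auto simp: s_def N_def part_index_part)
  have s_meas: "s k \<in> borel_measurable borel" for k
  proof -
    have i: "part_index n \<in> borel \<rightarrow>\<^sub>M count_space UNIV" for n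
      unfolding part_index_def by measurable
    have "(\<lambda>p::real \<times> real. real (v k (part_index n (fst p)) (part_index n (snd p))))
      \<in> borel_measurable borel" for n
    proof -
      have 1: "(\<lambda>p::real \<times> real. part_index n (fst p)) \<in> borel \<rightarrow>\<^sub>M count_space UNIV"
        by (rule measurable_compose[OF _ i]) (simp add: borel_prod[symmetric])
      have 2: "(\<lambda>p::real \<times> real. part_index n (snd p)) \<in> borel \<rightarrow>\<^sub>M count_space UNIV"
        by (rule measurable_compose[OF _ i]) (simp add: borel_prod[symmetric])
      show ?thesis
        by (rule measurable_compose_countable[OF _ 1], rule measurable_compose_countable[OF _ 2]) simp
    qed
    then show ?thesis
      unfolding s_def by (intro measurable_If_set borel_measurable_divide borel_measurable_const)
        (auto intro!: borel_closed closed_Times)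
  qed
  have graphon: "graphon (s k)" for k
    unfolding graphon_def
  proof (intro conjI ballI)
    show "s k \<in> borel_measurable (lebesgue_on unit_square)"
      using s_meas[of k] by (intro measurable_restrict_space1) (simp add: measurable_completion)
  qed (auto simp: s_def v_sym divide_le_eq_1 intro!: v_le simp del: of_nat_Suc)
  have "step_graphon (s k)" for k
    unfolding step_graphon_def
  proof (intro conjI graphon exI[of _ "N k"] allI impI)
    fix i j assume "i < N k" "j < N k"
    then show "\<exists>q\<in>\<rat>. \<forall>x\<in>part (N k) i. \<forall>y\<in>part (N k) j. s k (x, y) = q"
      using s_val by (intro bexI[of _ "real (v k i j) / real (Suc (D k))"]) auto
  qed (simp add: N_def)
  moreover have "\<exists>k. \<forall>p\<in>unit_square. s k p = W p" if W: "step_graphon W" for W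
  proof -
    obtain n where n: "n > 0"
      and ex: "\<forall>i<n. \<forall>j<n. \<exists>q\<in>\<rat>. \<forall>x\<in>part n i. \<forall>y\<in>part n j. W (x, y) = q"
      using W unfolding step_graphon_def by blast
    obtain n' where n': "n = Suc n'" using n gr0_implies_Suc by blast
    define w where "w i j = W (real i / real n, real j / real n)" for i j
    have w: "w i j \<in> \<rat>" "x \<in> part n i \<Longrightarrow> y \<in> part n j \<Longrightarrow> W (x, y) = w i j"
      if "i < n" "j < n" for i j x y
      using ex that part_nonempty[OF that(1)] part_nonempty[OF that(2)] unfolding w_def by metis+
    have wb: "w i j = w j i" "0 \<le> w i j" "w i j \<le> 1" if "i < n" "j < n" for i j
      using W that unfolding step_graphon_def graphon_def w_def by auto
    have "\<exists>d. \<forall>q\<in>(\<lambda>(i, j). w i j) ` ({..<n} \<times> {..<n}). q * real (Suc d) \<in> \<int>"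
      using w(1) by (intro ex_common_denominator) auto
    then obtain d where d: "w i j * real (Suc d) \<in> \<int>" if "i < n" "j < n" for i j
      by fastforce
    define u where "u p = (case prod_decode p of (i, j) \<Rightarrow> nat \<lfloor>w i j * real (Suc d)\<rfloor>)" for p
    obtain P where P: "\<forall>i<n. \<forall>j<n. cpair i j < P"
    proof
      show "\<forall>i<n. \<forall>j<n. cpair i j < Suc (Max (prod_encode ` ({..<n} \<times> {..<n})))"
        by (auto simp: less_Suc_eq_le intro!: Max_ge)
    qed
    obtain m where m: "\<forall>p<P. table m p = u p" using ex_table by blast
    define k where "k = cpair n' (cpair d m)"
    have k: "fst (prod_decode k) = n'" "N k = n" "D k = d" "M k = m"
      by (auto simp: k_def N_def D_def M_def n')
    have u: "real (u (cpair i j)) = w i j * real (Suc d)" "u (cpair i j) \<le> Suc d"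
      if "i < n" "j < n" for i j
    proof -
      obtain z where z: "w i j * real (Suc d) = of_int z" using Ints_cases[OF d[OF \<open>i < n\<close> \<open>j < n\<close>]] by metis
      have "0 \<le> w i j * real (Suc d)" "w i j * real (Suc d) \<le> real (Suc d)"
        using wb[OF that] by (auto intro: mult_left_le_one_le simp del: of_nat_Suc)
      then show "real (u (cpair i j)) = w i j * real (Suc d)" "u (cpair i j) \<le> Suc d"
        unfolding u_def by (auto simp: z simp del: of_nat_Suc)
    qed
    have v: "real (v k i j) / real (Suc d) = w i j" if "i < n" "j < n" for i j
    proof -
      have mm: "min i j < n" "max i j < n" using that by auto
      have "v k i j = u (cpair (min i j) (max i j))"
        using m P mm u(2)[OF mm] by (simp add: v_def mi ma k)
      then have "real (v k i j) / real (Suc d) = w (min i j) (max i j)"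
        using u(1)[OF mm] by (simp del: of_nat_Suc)
      also have "\<dots> = w i j"
        using wb(1)[OF that] by (auto simp: min_def max_def)
      finally show ?thesis .
    qed
    have "s k p = W p" if "p \<in> unit_square" for p
    proof -
      obtain x y where p: "p = (x, y)" "x \<in> {0..1}" "y \<in> {0..1}" using \<open>p \<in> unit_square\<close> by blast
      let ?i = "part_index n' x" and ?j = "part_index n' y"
      have ij: "?i < n" "?j < n" "x \<in> part n ?i" "y \<in> part n ?j"
        unfolding n' by (rule part_index_less mem_part_index p)+
      then have "s k (x, y) = w ?i ?j"
        using s_val[of ?i k ?j x y] v[of ?i ?j] by (simp add: k)
      also have "\<dots> = W (x, y)" using w(2)[OF ij] by simp
      finally show ?thesis by (simp add: p)
    qed
    then show ?thesis by blast
  qed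
  moreover have "\<exists>N a b. computable N \<and> computable a \<and> computable b \<and>
      (\<forall>k. N k > 0 \<and>
        (\<forall>i<N k. \<forall>j<N k. \<forall>x\<in>part (N k) i. \<forall>y\<in>part (N k) j.
          s k (x, y) = real (a (cpair k (cpair i j))) / real (Suc (b (cpair k (cpair i j))))))"
  proof (intro exI conjI)
    let ?k = "\<lambda>z. fst (prod_decode z)"
    let ?i = "\<lambda>z. fst (prod_decode (snd (prod_decode z)))"
    let ?j = "\<lambda>z. snd (prod_decode (snd (prod_decode z)))"
    note I = computable_from_comp[OF computable_from_fst] computable_from_comp[OF computable_from_snd]
      computable_from_id computable_from_Suc computable_from_diff computable_from_add
      computable_from_pair computable_from_table
    show "computable N" unfolding computable_def N_def by (intro I)
    show "computable (\<lambda>z. v (?k z) (?i z) (?j z))"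
      unfolding computable_def v_def mi_def ma_def D_def M_def by (intro I)
    show "computable (\<lambda>z. D (?k z))"
      unfolding computable_def D_def by (intro I)
    show "\<forall>k. N k > 0 \<and>
        (\<forall>i<N k. \<forall>j<N k. \<forall>x\<in>part (N k) i. \<forall>y\<in>part (N k) j.
          s k (x, y) = real (v (?k (cpair k (cpair i j))) (?i (cpair k (cpair i j))) (?j (cpair k (cpair i j))))
            / real (Suc (D (?k (cpair k (cpair i j))))))"
      using s_val by (auto simp: N_def)
  qed
  ultimately have "computable_enumeration s"
    unfolding computable_enumeration_def by blast
  then show ?thesis by blast
qed

end

theory Submission
  imports Defs
begin

text \<open>
  Given a cut-distance name of \<open>U\<close>, the integrals of \<open>U\<close> over the boxes of a grid are computable,
  since each of them is controlled by the cut norm. The L1 distance from a step graphon \<open>s\<close> to \<open>U\<close> is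
  the supremum over all grids of the sum of the absolute values of the box integrals of \<open>s - U\<close>.
  Hence \<open>L1_dist s U > c\<close> is semidecidable from the name and decidable from its jump, and the jump
  finds, for each \<open>j\<close>, a step graphon at L1 distance at most \<open>1 / 2 ^ Suc j\<close> from \<open>U\<close>.
\<close>

section \<open>Computability and the jump\<close>

text \<open>The terms of the given name need not approach \<open>U\<close> in L1: a quasirandom step
  graphon with values 0 and 1 is close to the constant 1/2 in the cut norm, yet at L1 distance 1/2
  from it. So the search runs through all step graphons, not just those in the name. Grid averages
  see cancellation and therefore bound an L1 distance from below only; this makes the distance
  approximable from below, and failing to exceed a bound is what the jump has to certify. A grid of
  n * n boxes accumulates n * n errors of the name, so the precision taken from the name must depend
  on the grid.\<close>

lemma computable_from_const: "computable_from f (\<lambda>x. c)"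
proof (induction c)
  case 0
  show ?case by (auto simp: computable_from_def intro: evaluates.Zero)
qed (rule computable_from_Suc)

lemma computable_from_mult:
  assumes g: "computable_from f g" and h: "computable_from f h"
  shows "computable_from f (\<lambda>x. g x * h x)"
proof -
  note I = computable_from_comp[OF computable_from_fst] computable_from_comp[OF computable_from_snd]
    computable_from_comp[OF g] computable_from_id computable_from_add
  have "computable_from f (\<lambda>x. rec_nat 0 (\<lambda>n r. (\<lambda>z. snd (prod_decode (snd (prod_decode z))) +
      g (fst (prod_decode z))) (cpair x (cpair n r))) (h x))"
    by (rule computable_from_rec[OF computable_from_const _ h]) (intro I)
  moreover have "rec_nat 0 (\<lambda>n r. r + a) b = a * b" for a b :: nat
    by (induction b) auto
  ultimately show ?thesis by simp
qed

lemma computable_from_power: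
  assumes g: "computable_from f g" and h: "computable_from f h"
  shows "computable_from f (\<lambda>x. g x ^ h x)"
proof -
  note I = computable_from_comp[OF computable_from_fst] computable_from_comp[OF computable_from_snd]
    computable_from_comp[OF g] computable_from_id computable_from_mult
  have "computable_from f (\<lambda>x. rec_nat 1 (\<lambda>n r. (\<lambda>z. snd (prod_decode (snd (prod_decode z))) *
      g (fst (prod_decode z))) (cpair x (cpair n r))) (h x))"
    by (rule computable_from_rec[OF computable_from_const _ h]) (intro I)
  moreover have "rec_nat 1 (\<lambda>n r. r * a) b = a ^ b" for a b :: nat
    by (induction b) auto
  ultimately show ?thesis by simp
qed

lemma computable_from_min:
  assumes "computable_from f g" and "computable_from f h"
  shows "computable_from f (\<lambda>x. min (g x) (h x))"
proof -
  have "min a b = a - (a - b)" for a b :: nat by auto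
  then show ?thesis using assms by (simp add: computable_from_diff)
qed

lemma computable_from_max:
  assumes "computable_from f g" and "computable_from f h"
  shows "computable_from f (\<lambda>x. max (g x) (h x))"
proof -
  have "max a b = a + (b - a)" for a b :: nat by auto
  then show ?thesis using assms by (simp add: computable_from_diff computable_from_add)
qed

lemma computable_from_of_bool_le:
  assumes "computable_from f g" and "computable_from f h"
  shows "computable_from f (\<lambda>x. of_bool (g x \<le> h x))"
proof -
  have "of_bool (a \<le> b) = 1 - (a - b)" for a b :: nat by auto
  then show ?thesis
    using computable_from_diff[OF computable_from_const[of _ 1] computable_from_diff[OF assms]]
    by simp
qed

section \<open>Unbounded search\<close>

text \<open>In general \<open>Mu p\<close> diverges either because no zero exists or because some
  value of \<open>p\<close> is undefined. Totality of \<open>p\<close> excludes the second cause, so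
  halting becomes a purely existential statement.\<close>

lemma evaluates_Mu_total:
  assumes p: "\<And>z. evaluates f p z (g z)"
  shows "(\<exists>y. evaluates f (Mu p) x y) \<longleftrightarrow> (\<exists>n. g (cpair x n) = 0)"
    and "\<exists>n. g (cpair x n) = 0 \<Longrightarrow> evaluates f (Mu p) x (LEAST n. g (cpair x n) = 0)"
proof -
  show *: "evaluates f (Mu p) x (LEAST n. g (cpair x n) = 0)" if "\<exists>n. g (cpair x n) = 0"
  proof (rule evaluates.Mu)
    show "evaluates f p (cpair x (LEAST n. g (cpair x n) = 0)) 0"
      using p[of "cpair x (LEAST n. g (cpair x n) = 0)"] LeastI_ex[OF that] by simp
    show "\<forall>m<LEAST n. g (cpair x n) = 0. \<exists>y>0. evaluates f p (cpair x m) y"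
      using p not_less_Least by blast
  qed
  show "(\<exists>y. evaluates f (Mu p) x y) \<longleftrightarrow> (\<exists>n. g (cpair x n) = 0)"
    using * p evaluates_unique by (metis evaluates_cases(9))
qed

lemma computable_from_Least:
  assumes "computable_from f g" and "\<And>x. \<exists>n. g (cpair x n) = 0"
  shows "computable_from f (\<lambda>x. LEAST n. g (cpair x n) = 0)"
  using assms evaluates_Mu_total(2) unfolding computable_from_def by metis

text \<open>Relative computability is transitive because every oracle call can be replaced by a
  program that computes the answer.\<close>

primrec subst_Query :: "prog \<Rightarrow> prog \<Rightarrow> prog" where
  "subst_Query r Zero = Zero"
| "subst_Query r Succ = Succ"
| "subst_Query r Fst = Fst"
| "subst_Query r Snd = Snd"
| "subst_Query r Query = r"
| "subst_Query r (Pair p q) = Pair (subst_Query r p) (subst_Query r q)"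
| "subst_Query r (Comp p q) = Comp (subst_Query r p) (subst_Query r q)"
| "subst_Query r (Prec p q) = Prec (subst_Query r p) (subst_Query r q)"
| "subst_Query r (Mu p) = Mu (subst_Query r p)"

lemma evaluates_subst_Query:
  assumes r: "\<And>x. evaluates f r x (h x)" and p: "evaluates h p x y"
  shows "evaluates f (subst_Query r p) x y"
  using p
proof (induction rule: evaluates.induct)
  case (Mu p x n)
  then show ?case by (auto intro!: evaluates.Mu)
qed (auto intro: evaluates.intros r)

lemma computable_from_trans:
  "computable_from f h \<Longrightarrow> computable_from h g \<Longrightarrow> computable_from f g"
  unfolding computable_from_def using evaluates_subst_Query by metis

text \<open>Lets the data of the enumeration, computable outright, be used next to the oracle for
  the name. The empty oracle is the constant 0, hence computable from anything.\<close>

lemma computable_imp_computable_from: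
  assumes "computable g"
  shows "computable_from f g"
proof (rule computable_from_trans)
  have "indicator {} = (\<lambda>x::nat. 0::nat)" by auto
  then show "computable_from f (indicator {})" by (simp add: computable_from_const)
  show "computable_from (indicator {}) g" using assms by (simp add: computable_def)
qed

text \<open>The jump runs a program only on its own code; numerals as programs allow any other input
  to be hard-wired, as in the s-m-n theorem.\<close>

primrec const_prog :: "nat \<Rightarrow> prog" where
  "const_prog 0 = Zero"
| "const_prog (Suc c) = Comp Succ (const_prog c)"

lemma evaluates_const_prog: "evaluates f (const_prog c) x c"
  by (induction c) (auto intro: evaluates.intros)

lemma computable_from_code_const_prog: "computable_from f (\<lambda>x. code (const_prog x))"
proof -
  note I = computable_from_comp[OF computable_from_snd] computable_from_const
    computable_from_id computable_from_pair
  \<comment> \<open>6 is the tag of \<open>Comp\<close> in \<open>code\<close>.\<close>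
  have "computable_from f (\<lambda>x. rec_nat (code Zero) (\<lambda>n r. (\<lambda>z. cpair 6 (cpair (code Succ)
      (snd (prod_decode (snd (prod_decode z)))))) (cpair x (cpair n r))) x)"
    by (rule computable_from_rec) (intro I)+
  moreover have "rec_nat (code Zero) (\<lambda>n r. cpair 6 (cpair (code Succ) r)) x = code (const_prog x)"
    for x by (induction x) auto
  ultimately show ?thesis by simp
qed

text \<open>
  Whether the search on \<open>x\<close> succeeds is a question about the program that ignores its own input and
  searches on \<open>x\<close> instead; the code of that program is computable from \<open>x\<close>.
\<close>

lemma computable_from_jump:
  assumes "computable_from f g"
  shows "computable_from (indicator (jump f)) (\<lambda>x. of_bool (\<exists>n. g (cpair x n) = 0))"
proof -
  obtain p where p: "\<And>z. evaluates f p z (g z)"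
    using assms unfolding computable_from_def by blast
  define c where "c x = code (Comp (Mu p) (const_prog x))" for x
  have "c x \<in> jump f \<longleftrightarrow> (\<exists>n. g (cpair x n) = 0)" for x
  proof -
    have "c x \<in> jump f \<longleftrightarrow> (\<exists>y. evaluates f (Comp (Mu p) (const_prog x)) (c x) y)"
      \<comment> \<open>Injectivity of \<open>code\<close> ensures that \<open>c x\<close> is the
        code of no other program.\<close>
      unfolding jump_def c_def using code_inject by blast
    also have "\<dots> \<longleftrightarrow> (\<exists>y. evaluates f (Mu p) x y)"
      by (metis evaluates.Comp evaluates_cases(7) evaluates_const_prog evaluates_unique)
    finally show ?thesis using evaluates_Mu_total(1)[OF p] by simp
  qed
  then have "indicator (jump f) (c x) = (of_bool (\<exists>n. g (cpair x n) = 0) :: nat)" for x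
    by (simp add: indicator_def)
  moreover have "computable_from (indicator (jump f)) (\<lambda>x. indicator (jump f) (c x))"
  proof (rule computable_from_comp[where h = c])
    show "computable_from (indicator (jump f)) (indicator (jump f))"
      unfolding computable_from_def using evaluates.Query by blast
    show "computable_from (indicator (jump f)) c"
      unfolding c_def code.simps
      by (intro computable_from_pair computable_from_const computable_from_code_const_prog)
  qed
  ultimately show ?thesis by simp
qed

section \<open>Computable rational functions\<close>

text \<open>The sign is carried by a difference of two naturals, as subtraction on
  \<open>nat\<close> is cut off at 0. \<open>Suc\<close> keeps the denominator positive without a
  side condition, and fractions need not be reduced.\<close>

definition rat_computable_from :: "(nat \<Rightarrow> nat) \<Rightarrow> (nat \<Rightarrow> real) \<Rightarrow> bool" where
  "rat_computable_from f h \<longleftrightarrow>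
     (\<exists>p q r. computable_from f p \<and> computable_from f q \<and> computable_from f r \<and>
        (\<forall>x. h x = (real (p x) - real (q x)) / real (Suc (r x))))"

lemma rat_computable_fromI:
  assumes "computable_from f p" "computable_from f q" "computable_from f r"
    and "\<And>x. h x = (real (p x) - real (q x)) / real (Suc (r x))"
  shows "rat_computable_from f h"
  using assms unfolding rat_computable_from_def by blast

lemma rat_computable_fromE:
  assumes "rat_computable_from f h"
  obtains p q r where "computable_from f p" "computable_from f q" "computable_from f r"
    and "\<And>x. h x = (real (p x) - real (q x)) / real (Suc (r x))"
  using assms unfolding rat_computable_from_def by blast

lemma rat_computable_from_of_nat: "computable_from f g \<Longrightarrow> rat_computable_from f (\<lambda>x. real (g x))"
  by (rule rat_computable_fromI[of _ g "\<lambda>_. 0" "\<lambda>_. 0"]) (auto intro: computable_from_const)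

lemma rat_computable_from_divide_nat:
  assumes h: "rat_computable_from f h" and g: "computable_from f g"
  shows "rat_computable_from f (\<lambda>x. h x / real (g x))"
proof -
  obtain p q r where pqr: "computable_from f p" "computable_from f q" "computable_from f r"
    and h: "\<And>x. h x = (real (p x) - real (q x)) / real (Suc (r x))"
    using h by (rule rat_computable_fromE) blast
  have g1: "computable_from f (\<lambda>x. of_bool (1 \<le> g x))"
    by (intro computable_from_of_bool_le g computable_from_const)
  show ?thesis
  proof (rule rat_computable_fromI)
    \<comment> \<open>Division by 0 gives 0, so \<open>of_bool\<close> erases the numerator where
      \<open>g x = 0\<close>. The \<open>- 1\<close> in the denominator is undone by the
      \<open>Suc\<close> of the representation.\<close>
    show "computable_from f (\<lambda>x. p x * of_bool (1 \<le> g x))"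
      "computable_from f (\<lambda>x. q x * of_bool (1 \<le> g x))"
      "computable_from f (\<lambda>x. g x * Suc (r x) - 1)"
      by (intro computable_from_mult computable_from_diff computable_from_Suc computable_from_const
        pqr g g1)+
    fix x
    show "h x / real (g x) = (real (p x * of_bool (1 \<le> g x)) - real (q x * of_bool (1 \<le> g x)))
        / real (Suc (g x * Suc (r x) - 1))"
    proof (cases "g x")
      case (Suc n)
      then have "Suc (g x * Suc (r x) - 1) = g x * Suc (r x)" by simp
      moreover have "real (p x * of_bool (1 \<le> g x)) = real (p x)"
        "real (q x * of_bool (1 \<le> g x)) = real (q x)" using Suc by simp_all
      ultimately show ?thesis by (simp only: h of_nat_mult divide_divide_eq_left mult.commute)
    qed simp
  qed
qed

lemma rat_computable_from_add:
  assumes "rat_computable_from f g" and "rat_computable_from f h"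
  shows "rat_computable_from f (\<lambda>x. g x + h x)"
proof -
  obtain p q r where pqr: "computable_from f p" "computable_from f q" "computable_from f r"
    and g: "\<And>x. g x = (real (p x) - real (q x)) / real (Suc (r x))"
    using assms(1) by (rule rat_computable_fromE) blast
  obtain p' q' r' where pqr': "computable_from f p'" "computable_from f q'" "computable_from f r'"
    and h: "\<And>x. h x = (real (p' x) - real (q' x)) / real (Suc (r' x))"
    using assms(2) by (rule rat_computable_fromE) blast
  show ?thesis
  proof (rule rat_computable_fromI)
    show "computable_from f (\<lambda>x. p x * Suc (r' x) + p' x * Suc (r x))"
      "computable_from f (\<lambda>x. q x * Suc (r' x) + q' x * Suc (r x))"
      "computable_from f (\<lambda>x. r x * Suc (r' x) + r' x)"
      by (intro computable_from_mult computable_from_add computable_from_Suc pqr pqr')+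
    fix x
    have "Suc (r x * Suc (r' x) + r' x) = Suc (r x) * Suc (r' x)" by simp
    then show "g x + h x = (real (p x * Suc (r' x) + p' x * Suc (r x))
        - real (q x * Suc (r' x) + q' x * Suc (r x))) / real (Suc (r x * Suc (r' x) + r' x))"
      unfolding g h by (simp add: add_frac_eq del: of_nat_Suc) (simp add: algebra_simps)
  qed
qed

lemma rat_computable_from_mult:
  assumes "rat_computable_from f g" and "rat_computable_from f h"
  shows "rat_computable_from f (\<lambda>x. g x * h x)"
proof -
  obtain p q r where pqr: "computable_from f p" "computable_from f q" "computable_from f r"
    and g: "\<And>x. g x = (real (p x) - real (q x)) / real (Suc (r x))"
    using assms(1) by (rule rat_computable_fromE) blast
  obtain p' q' r' where pqr': "computable_from f p'" "computable_from f q'" "computable_from f r'"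
    and h: "\<And>x. h x = (real (p' x) - real (q' x)) / real (Suc (r' x))"
    using assms(2) by (rule rat_computable_fromE) blast
  show ?thesis
  proof (rule rat_computable_fromI)
    show "computable_from f (\<lambda>x. p x * p' x + q x * q' x)"
      "computable_from f (\<lambda>x. p x * q' x + q x * p' x)"
      "computable_from f (\<lambda>x. r x * Suc (r' x) + r' x)"
      by (intro computable_from_mult computable_from_add computable_from_Suc pqr pqr')+
    fix x
    have "Suc (r x * Suc (r' x) + r' x) = Suc (r x) * Suc (r' x)" by simp
    then show "g x * h x = (real (p x * p' x + q x * q' x)
        - real (p x * q' x + q x * p' x)) / real (Suc (r x * Suc (r' x) + r' x))"
      unfolding g h by (simp del: of_nat_Suc) (simp add: algebra_simps)
  qed
qed

lemma rat_computable_from_diff: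
  assumes "rat_computable_from f g" and "rat_computable_from f h"
  shows "rat_computable_from f (\<lambda>x. g x - h x)"
proof -
  have m: "rat_computable_from f (\<lambda>x. - 1)"
    by (rule rat_computable_fromI[of _ "\<lambda>_. 0" "\<lambda>_. 1" "\<lambda>_. 0"]) (auto intro: computable_from_const)
  have "rat_computable_from f (\<lambda>x. g x + - 1 * h x)"
    by (intro rat_computable_from_add rat_computable_from_mult m assms)
  then show ?thesis by simp
qed

lemma rat_computable_from_abs:
  assumes "rat_computable_from f h"
  shows "rat_computable_from f (\<lambda>x. \<bar>h x\<bar>)"
proof -
  obtain p q r where pqr: "computable_from f p" "computable_from f q" "computable_from f r"
    and h: "\<And>x. h x = (real (p x) - real (q x)) / real (Suc (r x))"
    using assms by (rule rat_computable_fromE) blast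
  show ?thesis
  proof (rule rat_computable_fromI)
    \<comment> \<open>One of the two truncated differences is 0, the other is the absolute
      value.\<close>
    show "computable_from f (\<lambda>x. (p x - q x) + (q x - p x))"
      "computable_from f (\<lambda>x. 0)" "computable_from f r"
      by (intro computable_from_add computable_from_diff computable_from_const pqr)+
    show "\<bar>h x\<bar> = (real (p x - q x + (q x - p x)) - real 0) / real (Suc (r x))" for x
      unfolding h by (cases "p x \<le> q x") (auto simp: abs_divide of_nat_diff)
  qed
qed

text \<open>The gain from exact fractions: their order is decidable, whereas that of computable
  reals is not.\<close>

lemma computable_from_rat_le:
  assumes "rat_computable_from f g" and "rat_computable_from f h"
  shows "computable_from f (\<lambda>x. of_bool (g x \<le> h x))"
proof -
  obtain p q r where pqr: "computable_from f p" "computable_from f q" "computable_from f r"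
    and gh: "\<And>x. g x - h x = (real (p x) - real (q x)) / real (Suc (r x))"
    using rat_computable_from_diff[OF assms] by (rule rat_computable_fromE) blast
  have "g x \<le> h x \<longleftrightarrow> p x \<le> q x" for x
  proof -
    have "g x \<le> h x \<longleftrightarrow> (real (p x) - real (q x)) / real (Suc (r x)) \<le> 0"
      unfolding gh[symmetric] by simp
    also have "\<dots> \<longleftrightarrow> p x \<le> q x" by (simp add: divide_le_0_iff)
    finally show ?thesis .
  qed
  then show ?thesis using computable_from_of_bool_le[OF pqr(1,2)] by simp
qed

text \<open>The summation index becomes the second component of the coded argument, so nested sums
  are handled by repeated use of the rule.\<close>

lemma rat_computable_from_sum:
  assumes h: "rat_computable_from f (\<lambda>z. h (fst (prod_decode z)) (snd (prod_decode z)))"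
    and t: "computable_from f t"
  shows "rat_computable_from f (\<lambda>x. \<Sum>n<t x. h x n)"
proof -
  obtain p q r where pqr: "computable_from f p" "computable_from f q" "computable_from f r"
    and h: "\<And>z. h (fst (prod_decode z)) (snd (prod_decode z)) =
      (real (p z) - real (q z)) / real (Suc (r z))"
    using h by (rule rat_computable_fromE) blast
  let ?F = "\<lambda>u. fst (prod_decode u)" and ?S = "\<lambda>u. snd (prod_decode u)"
  \<comment> \<open>The recursion sees \<open>z\<close>, coding \<open>x\<close>, \<open>n\<close>
    and the partial sum; the latter is a coded triple \<open>?P\<close>, \<open>?Q\<close>,
    \<open>?R\<close> in the representation of \<open>rat_computable_from\<close>. \<open>G\<close>
    adds the fraction for \<open>?y z\<close>.\<close>
  let ?y = "\<lambda>z. cpair (?F z) (?F (?S z))" and ?P = "\<lambda>z. ?F (?S (?S z))"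
    and ?Q = "\<lambda>z. ?F (?S (?S (?S z)))" and ?R = "\<lambda>z. ?S (?S (?S (?S z)))"
  define G where "G z = cpair (?P z * Suc (r (?y z)) + p (?y z) * Suc (?R z))
      (cpair (?Q z * Suc (r (?y z)) + q (?y z) * Suc (?R z)) (?R z * Suc (r (?y z)) + r (?y z)))" for z
  define A where "A x m = rec_nat 0 (\<lambda>n u. G (cpair x (cpair n u))) m" for x m
  note I = computable_from_comp[OF computable_from_fst] computable_from_comp[OF computable_from_snd]
    computable_from_comp[OF pqr(1)] computable_from_comp[OF pqr(2)] computable_from_comp[OF pqr(3)]
    computable_from_id computable_from_add computable_from_mult computable_from_Suc
    computable_from_pair computable_from_const
  have "computable_from f G" unfolding G_def by (intro I)
  then have A: "computable_from f (\<lambda>x. A x (t x))"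
    unfolding A_def by (intro computable_from_rec t computable_from_const)
  \<comment> \<open>The start value 0 thus codes the triple of zeros, which is the fraction 0 /
    1.\<close>
  have "prod_decode 0 = (0, 0)" by (simp add: prod_decode_def prod_decode_aux.simps)
  have *: "(\<Sum>n<m. h x n) = (real (?F (A x m)) - real (?F (?S (A x m)))) / real (Suc (?S (?S (A x m))))"
    for x m
  proof (induction m)
    case 0
    then show ?case by (simp add: A_def \<open>prod_decode 0 = (0, 0)\<close>)
  next
    case (Suc m)
    let ?z = "cpair x (cpair m (A x m))"
    have "A x (Suc m) = G ?z" by (simp add: A_def)
    moreover have "Suc (?R ?z * Suc (r (?y ?z)) + r (?y ?z)) = Suc (?R ?z) * Suc (r (?y ?z))" by simp
    moreover have "h x m = (real (p (cpair x m)) - real (q (cpair x m))) / real (Suc (r (cpair x m)))"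
      using h[of "cpair x m"] by simp
    ultimately show ?case
      by (simp add: Suc G_def add_frac_eq del: of_nat_Suc) (simp add: algebra_simps)
  qed
  show ?thesis
    by (rule rat_computable_fromI[where p = "\<lambda>x. ?F (A x (t x))" and q = "\<lambda>x. ?F (?S (A x (t x)))"
      and r = "\<lambda>x. ?S (?S (A x (t x)))"]) (intro I A *)+
qed

section \<open>Box integrals and distances\<close>

lemma unit_square_lmeasurable: "unit_square \<in> lmeasurable"
  by (intro lmeasurable_compact compact_Times) auto

text \<open>Moves all integrals to one finite measure space, the one in which graphons are assumed
  measurable and in which bounded measurable functions are integrable.\<close>

lemma set_integral_unit_square:
  assumes "A \<subseteq> unit_square"
  shows "(LINT p:A|lebesgue. F p) = (LINT p|lebesgue_on unit_square. indicator A p * (F p :: real))"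
proof -
  have "indicator unit_square p * (indicator A p * F p) = indicator A p * F p" for p
    using assms by (auto simp: indicator_def)
  then show ?thesis
    using unit_square_lmeasurable unfolding set_lebesgue_integral_def
    by (subst integral_restrict_space) (simp_all only: real_scaleR_def, simp)
qed

lemma L1_norm_eq: "L1_norm F = (LINT p|lebesgue_on unit_square. \<bar>F p\<bar>)"
proof -
  have "(LINT p|lebesgue_on unit_square. indicator unit_square p * \<bar>F p\<bar>) =
      (LINT p|lebesgue_on unit_square. \<bar>F p\<bar>)"
    by (intro Bochner_Integration.integral_cong) auto
  then show ?thesis unfolding L1_norm_def by (subst set_integral_unit_square) auto
qed

lemma integrable_unit_square:
  fixes F :: "real \<times> real \<Rightarrow> real"
  assumes "F \<in> borel_measurable (lebesgue_on unit_square)" and "\<And>p. p \<in> unit_square \<Longrightarrow> \<bar>F p\<bar> \<le> B"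
  shows "integrable (lebesgue_on unit_square) F"
  using assms finite_measure_lebesgue_on[OF unit_square_lmeasurable]
  by (intro finite_measure.integrable_const_bound[where B = B] AE_I2) auto

lemma integrable_graphon:
  assumes "graphon W"
  shows "integrable (lebesgue_on unit_square) W"
  using assms by (intro integrable_unit_square[where B = 1]) (auto simp: graphon_def)

section \<open>Grids and box integrals\<close>

lemma sets_part [measurable]: "part n i \<in> sets borel"
  by (simp add: part_def)

lemma sets_box: "part n i \<times> part n j \<in> sets borel"
  by (intro borel_Times sets_part)

text \<open>Products of grid sizes yield common refinements: with the factors exchanged, the same
  grid also refines the one of size \<open>N\<close>.\<close>

lemma part_mult:
  assumes i: "i < M * N"
  shows "part (M * N) i \<subseteq> part M (i div N)"
proof
  fix x assume x: "x \<in> part (M * N) i"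
  have MN: "M > 0" "N > 0" using i by (auto intro: gr0I)
  let ?a = "i div N"
  have "real ?a / real M = real (?a * N) / real (M * N)" using MN by simp
  also have "\<dots> \<le> real i / real (M * N)"
    by (intro divide_right_mono of_nat_mono) (simp_all add: div_times_less_eq_dividend)
  also have "\<dots> \<le> x" using x by (auto simp: part_def split: if_splits)
  finally have lower: "real ?a / real M \<le> x" .
  show "x \<in> part M ?a"
  proof (cases "Suc ?a = M")
    \<comment> \<open>The last coarse part is closed, so the upper bound 1 suffices.\<close>
    case True
    then show ?thesis using lower part_subset[OF i] x by (auto simp: part_def)
  next
    case False
    have "?a < M" using i by (simp add: less_mult_imp_div_less)
    have le: "Suc i \<le> Suc ?a * N" using dividend_less_div_times[OF MN(2), of i] by simp
    also have "\<dots> < M * N" using False \<open>?a < M\<close> MN(2) by (intro mult_strict_right_mono) auto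
    finally have "x < real (Suc i) / real (M * N)" using x by (auto simp: part_def)
    also have "\<dots> \<le> real (Suc ?a * N) / real (M * N)"
      using le by (intro divide_right_mono of_nat_mono) auto
    also have "\<dots> = real (Suc ?a) / real M" using MN by (simp del: of_nat_Suc mult_Suc)
    finally show ?thesis using lower False by (simp add: part_def)
  qed
qed

text \<open>The parts partition the unit interval, so exactly one indicator is nonzero at
  \<open>p\<close>. With \<open>W\<close> constantly 1 this is a partition of unity.\<close>

lemma step_expansion:
  fixes W :: "real \<times> real \<Rightarrow> real"
  assumes n: "n > 0"
    and W: "\<And>i j x y. i < n \<Longrightarrow> j < n \<Longrightarrow> x \<in> part n i \<Longrightarrow> y \<in> part n j \<Longrightarrow> W (x, y) = v i j"
    and p: "p \<in> unit_square"
  shows "W p = (\<Sum>i<n. \<Sum>j<n. v i j * indicator (part n i \<times> part n j) p)"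
proof -
  obtain m where m: "n = Suc m" using n gr0_implies_Suc by blast
  obtain x y where xy: "p = (x, y)" "x \<in> {0..1}" "y \<in> {0..1}" using p by blast
  define a b where "a = part_index m x" and "b = part_index m y"
  have ab: "a < n" "b < n" "x \<in> part n a" "y \<in> part n b"
    unfolding a_def b_def m by (rule part_index_less mem_part_index xy)+
  have "x \<in> part n i \<longleftrightarrow> i = a" if "i < n" for i
    using part_index_part[of i m x] that ab by (auto simp: a_def m)
  moreover have "y \<in> part n j \<longleftrightarrow> j = b" if "j < n" for j
    using part_index_part[of j m y] that ab by (auto simp: b_def m)
  ultimately have "indicator (part n i \<times> part n j) p = of_bool (i = a) * (of_bool (j = b) :: real)"
    if "i < n" "j < n" for i j
    using that by (simp add: indicator_times indicator_def xy(1))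
  then have "(\<Sum>i<n. \<Sum>j<n. v i j * indicator (part n i \<times> part n j) p) =
      (\<Sum>i<n. \<Sum>j<n. if i = a then if j = b then v i j else 0 else 0)"
    by (intro sum.cong) auto
  also have "\<dots> = (\<Sum>i<n. if i = a then \<Sum>j<n. if j = b then v i j else 0 else 0)"
    by (intro sum.cong) auto
  also have "\<dots> = W p" using ab xy W[OF ab] by simp
  finally show ?thesis ..
qed

definition box_integral :: "nat \<Rightarrow> nat \<Rightarrow> nat \<Rightarrow> (real \<times> real \<Rightarrow> real) \<Rightarrow> real" where
  "box_integral n i j F = (LINT p:part n i \<times> part n j|lebesgue. F p)"

lemma box_integral_eq:
  assumes "i < n" and "j < n"
  shows "box_integral n i j F =
    (LINT p|lebesgue_on unit_square. indicator (part n i \<times> part n j) p * F p)"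
  unfolding box_integral_def using assms part_subset
  by (intro set_integral_unit_square Sigma_mono) auto

lemma integrable_box:
  assumes "i < n" and "j < n" and "integrable (lebesgue_on unit_square) F"
  shows "integrable (lebesgue_on unit_square) (\<lambda>p. indicator (part n i \<times> part n j) p * F p :: real)"
proof -
  have "part n i \<times> part n j \<subseteq> unit_square" using assms part_subset by (intro Sigma_mono) auto
  then have "part n i \<times> part n j \<in> sets (lebesgue_on unit_square)"
    using sets_box unit_square_lmeasurable by (auto simp: sets_restrict_space_iff)
  from integrable_real_mult_indicator[OF this assms(3)] show ?thesis by (simp add: mult.commute)
qed

lemma box_integral_diff:
  assumes "i < n" and "j < n" and "integrable (lebesgue_on unit_square) F"
    and "integrable (lebesgue_on unit_square) G"
  shows "box_integral n i j (\<lambda>p. F p - G p) = box_integral n i j F - box_integral n i j G"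
  using integrable_box[OF assms(1,2,3)] integrable_box[OF assms(1,2,4)]
  by (simp add: box_integral_eq[OF assms(1,2)] right_diff_distrib)

lemma integral_sum_sum:
  fixes G :: "nat \<Rightarrow> nat \<Rightarrow> 'a \<Rightarrow> real"
  assumes "\<And>i j. i < m \<Longrightarrow> j < n \<Longrightarrow> integrable M (G i j)"
  shows "(LINT p|M. (\<Sum>i<m. \<Sum>j<n. G i j p)) = (\<Sum>i<m. \<Sum>j<n. (LINT p|M. G i j p))"
proof -
  have "(LINT p|M. (\<Sum>i<m. \<Sum>j<n. G i j p)) = (\<Sum>i<m. (LINT p|M. (\<Sum>j<n. G i j p)))"
    using assms by (intro Bochner_Integration.integral_sum Bochner_Integration.integrable_sum) auto
  also have "\<dots> = (\<Sum>i<m. \<Sum>j<n. (LINT p|M. G i j p))"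
    using assms by (intro sum.cong Bochner_Integration.integral_sum) auto
  finally show ?thesis .
qed

lemma sum_box_integral:
  assumes "n > 0" and F: "integrable (lebesgue_on unit_square) F"
  shows "(\<Sum>i<n. \<Sum>j<n. box_integral n i j F) = (LINT p|lebesgue_on unit_square. F p)"
proof -
  define G where "G i j p = indicator (part n i \<times> part n j) p * F p" for i j p
  have G: "integrable (lebesgue_on unit_square) (G i j)" if "i < n" "j < n" for i j
    unfolding G_def using that F by (rule integrable_box)
  have "(\<Sum>i<n. \<Sum>j<n. box_integral n i j F) =
      (\<Sum>i<n. \<Sum>j<n. (LINT p|lebesgue_on unit_square. G i j p))"
    by (simp add: box_integral_eq G_def)
  also have "\<dots> = (LINT p|lebesgue_on unit_square. (\<Sum>i<n. \<Sum>j<n. G i j p))"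
    using G by (intro integral_sum_sum[symmetric])
  also have "\<dots> = (LINT p|lebesgue_on unit_square. F p)"
  proof (rule Bochner_Integration.integral_cong)
    fix p assume "p \<in> space (lebesgue_on unit_square)"
    then have "1 = (\<Sum>i<n. \<Sum>j<n. 1 * indicator (part n i \<times> part n j) p :: real)"
      using \<open>n > 0\<close> by (intro step_expansion[where W = "\<lambda>_. 1"]) auto
    then show "(\<Sum>i<n. \<Sum>j<n. G i j p) = F p"
      unfolding G_def sum_distrib_right[symmetric] by (simp only: mult_1)
  qed simp
  finally show ?thesis .
qed

text \<open>For positive \<open>n\<close> this is the L1 norm of the conditional expectation of
  \<open>F\<close> on the boxes of the grid: the area of a box cancels against the average over
  it.\<close>

definition grid_norm :: "nat \<Rightarrow> (real \<times> real \<Rightarrow> real) \<Rightarrow> real" where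
  "grid_norm n F = (\<Sum>i<n. \<Sum>j<n. \<bar>box_integral n i j F\<bar>)"

lemma abs_box_integral_le:
  assumes "i < n" and "j < n" and "integrable (lebesgue_on unit_square) F"
  shows "\<bar>box_integral n i j F\<bar> \<le> box_integral n i j (\<lambda>p. \<bar>F p\<bar>)"
proof -
  have "\<bar>box_integral n i j F\<bar> \<le>
      (LINT p|lebesgue_on unit_square. \<bar>indicator (part n i \<times> part n j) p * F p\<bar>)"
    unfolding box_integral_eq[OF assms(1,2)] by (rule integral_abs_bound)
  then show ?thesis by (simp add: box_integral_eq[OF assms(1,2)] abs_mult)
qed

lemma grid_norm_le_L1_norm:
  assumes F: "integrable (lebesgue_on unit_square) F"
  shows "grid_norm n F \<le> L1_norm F"
proof (cases "n = 0")
  case True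
  then show ?thesis by (simp add: grid_norm_def L1_norm_eq)
next
  case False
  have "grid_norm n F \<le> (\<Sum>i<n. \<Sum>j<n. box_integral n i j (\<lambda>p. \<bar>F p\<bar>))"
    unfolding grid_norm_def by (intro sum_mono abs_box_integral_le F) auto
  also have "\<dots> = L1_norm F"
    unfolding L1_norm_eq using False F by (intro sum_box_integral) auto
  finally show ?thesis .
qed

text \<open>Where \<open>F\<close> is constant on a box nothing cancels, and the absolute value
  passes through the integral.\<close>

lemma grid_norm_step:
  assumes F: "integrable (lebesgue_on unit_square) F" and "n > 0"
    and const: "\<And>i j x y. i < n \<Longrightarrow> j < n \<Longrightarrow> x \<in> part n i \<Longrightarrow> y \<in> part n j \<Longrightarrow> F (x, y) = v i j"
  shows "grid_norm n F = L1_norm F"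
proof -
  have "\<bar>box_integral n i j F\<bar> = box_integral n i j (\<lambda>p. \<bar>F p\<bar>)" if ij: "i < n" "j < n" for i j
  proof -
    let ?b = "LINT p|lebesgue_on unit_square. indicator (part n i \<times> part n j) p :: real"
    have "(\<lambda>p. indicator (part n i \<times> part n j) p * F p) =
        (\<lambda>p. indicator (part n i \<times> part n j) p * v i j)"
      using const[OF ij] by (auto simp: indicator_def)
    then have "box_integral n i j F = ?b * v i j"
      unfolding box_integral_eq[OF ij] by (simp only: integral_mult_left_zero)
    moreover have "(\<lambda>p. indicator (part n i \<times> part n j) p * \<bar>F p\<bar>) =
        (\<lambda>p. indicator (part n i \<times> part n j) p * \<bar>v i j\<bar>)"
      using const[OF ij] by (auto simp: indicator_def)
    then have "box_integral n i j (\<lambda>p. \<bar>F p\<bar>) = ?b * \<bar>v i j\<bar>"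
      unfolding box_integral_eq[OF ij] by (simp only: integral_mult_left_zero)
    moreover have "?b \<ge> 0" by (intro Bochner_Integration.integral_nonneg) auto
    ultimately show ?thesis by (simp only: abs_mult abs_of_nonneg)
  qed
  then have "grid_norm n F = (\<Sum>i<n. \<Sum>j<n. box_integral n i j (\<lambda>p. \<bar>F p\<bar>))"
    unfolding grid_norm_def by simp
  also have "\<dots> = L1_norm F"
    unfolding L1_norm_eq using F \<open>n > 0\<close> by (intro sum_box_integral) auto
  finally show ?thesis .
qed

section \<open>The L1 distance and the cut distance\<close>

lemma L1_dist_triangle:
  assumes "graphon U" and "graphon V" and "graphon W"
  shows "L1_dist U W \<le> L1_dist U V + L1_dist V W"
proof -
  note I = integrable_graphon[OF assms(1)] integrable_graphon[OF assms(2)] integrable_graphon[OF assms(3)]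
  have "(LINT p|lebesgue_on unit_square. \<bar>U p - W p\<bar>) \<le>
      (LINT p|lebesgue_on unit_square. \<bar>U p - V p\<bar> + \<bar>V p - W p\<bar>)"
    using I by (intro integral_mono Bochner_Integration.integrable_add integrable_abs
      Bochner_Integration.integrable_diff) auto
  also have "\<dots> = L1_dist U V + L1_dist V W"
    unfolding L1_dist_def L1_norm_eq
    using I by (intro Bochner_Integration.integral_add integrable_abs
      Bochner_Integration.integrable_diff) auto
  finally show ?thesis by (simp add: L1_dist_def L1_norm_eq)
qed

lemma L1_dist_commute: "L1_dist U W = L1_dist W U"
  by (simp add: L1_dist_def L1_norm_def abs_minus_commute)

lemma L1_dist_nonneg: "0 \<le> L1_dist U W"
  by (simp add: L1_dist_def L1_norm_eq)

text \<open>A box is one of the rectangles in the supremum. The work lies in \<open>bound\<close>,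
  since a real supremum dominates its members only if the family is bounded above.\<close>

lemma abs_box_integral_le_cut_dist:
  assumes "graphon U" and "graphon W" and "i < n" and "j < n"
  shows "\<bar>box_integral n i j (\<lambda>p. U p - W p)\<bar> \<le> cut_dist U W"
proof -
  define F where "F = (\<lambda>p. U p - W p)"
  have F: "integrable (lebesgue_on unit_square) F"
    unfolding F_def using assms by (intro Bochner_Integration.integrable_diff integrable_graphon)
  have bound: "\<bar>LINT p:S \<times> T|lebesgue. F p\<bar> \<le> L1_norm F"
    if ST: "S \<subseteq> {0..1}" "T \<subseteq> {0..1}" for S T
  proof -
    let ?G = "\<lambda>p. indicator (S \<times> T) p * F p"
    have eq: "(LINT p:S \<times> T|lebesgue. F p) = (LINT p|lebesgue_on unit_square. ?G p)"
      using ST by (intro set_integral_unit_square) auto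
    show ?thesis
    proof (cases "integrable (lebesgue_on unit_square) ?G")
      case True
      have "\<bar>LINT p|lebesgue_on unit_square. ?G p\<bar> \<le> (LINT p|lebesgue_on unit_square. \<bar>?G p\<bar>)"
        by (rule integral_abs_bound)
      also have "\<dots> \<le> (LINT p|lebesgue_on unit_square. \<bar>F p\<bar>)"
        using True F by (intro integral_mono integrable_abs) (auto simp: indicator_def)
      finally show ?thesis unfolding eq L1_norm_eq .
    next
      \<comment> \<open>\<open>bound\<close> covers arbitrary \<open>S\<close> and \<open>T\<close>;
        the integral of a function that is not integrable is 0.\<close>
      case False
      then show ?thesis unfolding eq L1_norm_eq by (simp add: not_integrable_integral_eq)
    qed
  qed
  have parts: "part n k \<in> {S \<in> sets lebesgue. S \<subseteq> {0..1}}" if "k < n" for k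
    using part_subset[OF that] by simp
  show ?thesis
    unfolding cut_dist_def cut_norm_def F_def[symmetric] box_integral_def
    by (rule cSUP_upper2[where x = "(part n i, part n j)"])
      (use parts assms bound in \<open>auto intro!: bdd_aboveI2[where M = "L1_norm F"]\<close>)
qed

section \<open>Exact box integrals of step functions\<close>

text \<open>Over the common denominator \<open>n * N\<close> the endpoints of both parts are
  integers. Truncated subtraction gives disjoint parts length 0 and keeps the formula in a form that
  \<open>rat_computable_from\<close> handles.\<close>

lemma measure_part_Int:
  assumes "p < n" and "i < N"
  shows "measure lborel (part n p \<inter> part N i) =
    real (min (Suc p * N) (Suc i * n) - max (p * N) (i * n)) / real (n * N)"
proof -
  have pos: "n > 0" "N > 0" using assms by auto
  define A B where "A = max (p * N) (i * n)" and "B = min (Suc p * N) (Suc i * n)"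
  define D where "D = real (n * N)"
  let ?S = "part n p \<inter> part N i"
  have D: "D > 0" using pos by (simp add: D_def)
  have A: "real A / D = max (real p / real n) (real i / real N)"
  proof -
    have "real p / real n = real (p * N) / D" "real i / real N = real (i * n) / D"
      using pos by (simp_all add: D_def)
    then show ?thesis using D by (simp only: A_def of_nat_max max_divide_distrib_right) simp
  qed
  have B: "real B / D = min (real (Suc p) / real n) (real (Suc i) / real N)"
  proof -
    have "real (Suc p) / real n = real (Suc p * N) / D" "real (Suc i) / real N = real (Suc i * n) / D"
      using pos by (simp_all add: D_def del: of_nat_Suc mult_Suc)
    then show ?thesis using D by (simp only: B_def of_nat_min min_divide_distrib_right) simp
  qed
  have sub: "{real p / real n<..<real (Suc p) / real n} \<subseteq> part n p"
    "part n p \<subseteq> {real p / real n..real (Suc p) / real n}" if "p < n" for n p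
    using that by (auto simp: part_def)
  \<comment> \<open>Squeezing between the open and the closed interval with the same endpoints
    avoids tracking which parts are half-open.\<close>
  have lower: "{real A / D<..<real B / D} \<subseteq> ?S"
    unfolding A B using sub(1)[OF assms(1)] sub(1)[OF assms(2)] by fastforce
  have upper: "?S \<subseteq> {real A / D..real B / D}"
    unfolding A B using sub(2)[OF assms(1)] sub(2)[OF assms(2)] by fastforce
  have f': "{real A / D..real B / D} \<in> fmeasurable lborel"
    by (auto intro!: fmeasurableI simp: emeasure_lborel_Icc_eq)
  then have f: "?S \<in> fmeasurable lborel"
    by (rule fmeasurableI2[OF _ upper]) auto
  have "measure lborel {real A / D<..<real B / D} \<le> measure lborel ?S"
    by (rule measure_mono_fmeasurable[OF lower]) (use f in auto)
  moreover have "measure lborel ?S \<le> measure lborel {real A / D..real B / D}"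
    by (rule measure_mono_fmeasurable[OF upper _ f']) auto
  moreover have "real A / D \<le> real B / D \<longleftrightarrow> A \<le> B"
    using D by (simp add: divide_le_cancel)
  ultimately have "measure lborel ?S = (if A \<le> B then real B / D - real A / D else 0)"
    by (auto simp: measure_nonneg order_antisym)
  also have "\<dots> = real (B - A) / D" by (simp add: of_nat_diff diff_divide_distrib)
  finally show ?thesis by (simp only: A_def B_def D_def)
qed

lemma measure_lborel_Times:
  fixes A B :: "real set"
  assumes "A \<in> sets borel" and "B \<in> sets borel"
  shows "measure lborel (A \<times> B) = measure lborel A * measure lborel B"
proof -
  have "emeasure lborel (A \<times> B) = emeasure lborel A * emeasure lborel B"
    using assms lborel.emeasure_pair_measure_Times[of A lborel B] by (simp add: lborel_prod)
  then show ?thesis by (simp add: measure_def enn2real_mult)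
qed

text \<open>The step grid of \<open>W\<close> cuts the box into rectangles on which \<open>W\<close>
  is constant and whose side lengths are overlaps of parts, hence rational.\<close>

lemma box_integral_step:
  assumes "N > 0"
    and W: "\<And>i j x y. i < N \<Longrightarrow> j < N \<Longrightarrow> x \<in> part N i \<Longrightarrow> y \<in> part N j \<Longrightarrow> W (x, y) = v i j"
    and pq: "p < n" "q < n"
  shows "box_integral n p q W = (\<Sum>i<N. \<Sum>j<N. v i j *
    (measure lborel (part n p \<inter> part N i) * measure lborel (part n q \<inter> part N j)))"
proof -
  define C where "C i j = (part n p \<inter> part N i) \<times> (part n q \<inter> part N j)" for i j
  have sub: "C i j \<subseteq> unit_square" for i j
    unfolding C_def using part_subset[OF pq(1)] part_subset[OF pq(2)] by (intro Sigma_mono) auto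
  have borel: "C i j \<in> sets borel" for i j
    unfolding C_def by (intro borel_Times sets.Int sets_part)
  have meas: "C i j \<in> sets (lebesgue_on unit_square)" for i j
    using sub borel unit_square_lmeasurable by (auto simp: sets_restrict_space_iff)
  have measure: "measure (lebesgue_on unit_square) (C i j) =
      measure lborel (part n p \<inter> part N i) * measure lborel (part n q \<inter> part N j)" for i j
  proof -
    have "measure (lebesgue_on unit_square) (C i j) = measure lebesgue (C i j)"
      using sub unit_square_lmeasurable by (intro measure_restrict_space) auto
    also have "\<dots> = measure lborel (C i j)"
      using borel by (intro measure_completion) auto
    finally show ?thesis
      unfolding C_def by (subst (asm) measure_lborel_Times) (auto intro: sets.Int sets_part)
  qed
  have int: "integrable (lebesgue_on unit_square) (\<lambda>z. v i j * indicator (C i j) z)" for i j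
    using finite_measure.emeasure_finite[OF finite_measure_lebesgue_on[OF unit_square_lmeasurable]]
    by (intro integrable_mult_right integrable_real_indicator meas) (simp add: less_top[symmetric])
  have "box_integral n p q W =
      (LINT z|lebesgue_on unit_square. (\<Sum>i<N. \<Sum>j<N. v i j * indicator (C i j) z))"
    unfolding box_integral_eq[OF pq]
  proof (rule Bochner_Integration.integral_cong)
    fix z assume "z \<in> space (lebesgue_on unit_square)"
    then have "W z = (\<Sum>i<N. \<Sum>j<N. v i j * indicator (part N i \<times> part N j) z)"
      using \<open>N > 0\<close> W by (intro step_expansion) auto
    then show "indicator (part n p \<times> part n q) z * W z =
        (\<Sum>i<N. \<Sum>j<N. v i j * indicator (C i j) z)"
      by (simp only: sum_distrib_left C_def Times_Int_Times[symmetric] indicator_inter_arith mult_ac)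
  qed simp
  also have "\<dots> = (\<Sum>i<N. \<Sum>j<N. v i j * measure (lebesgue_on unit_square) (C i j))"
    using int sub by (subst integral_sum_sum) (simp_all add: Int_absorb2 del: Times_Int_Times)
  finally show ?thesis by (simp only: measure)
qed

section \<open>Density of the step graphons\<close>

text \<open>By uniform continuity the value at the lower left corner of a box serves the whole box.
  One half of \<open>e\<close> pays for this, the other for rounding to a rational.\<close>

lemma step_graphon_near_continuous:
  fixes g :: "real \<times> real \<Rightarrow> real"
  assumes cont: "continuous_on unit_square g"
    and sym: "\<And>x y. g (x, y) = g (y, x)" and bounds: "\<And>p. 0 \<le> g p \<and> g p \<le> 1"
    and e: "e > 0"
  obtains W where "step_graphon W" and "\<And>p. p \<in> unit_square \<Longrightarrow> \<bar>W p - g p\<bar> \<le> e"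
proof -
  have "uniformly_continuous_on unit_square g"
    using cont by (intro compact_uniformly_continuous compact_Times) auto
  then obtain \<delta> where \<delta>: "\<delta> > 0"
    and uc: "\<And>p q. p \<in> unit_square \<Longrightarrow> q \<in> unit_square \<Longrightarrow> dist p q < \<delta> \<Longrightarrow> dist (g p) (g q) < e / 2"
    using e unfolding uniformly_continuous_on_def by (metis half_gt_zero dist_commute)
  \<comment> \<open>Half of \<delta>, as the distance to the corner is at most the sum of two
    coordinate distances.\<close>
  obtain m where m: "1 / real (Suc m) < \<delta> / 2" using nat_approx_posE[of "\<delta> / 2"] \<delta> by auto
  obtain d where d: "1 / real (Suc d) < e / 2" using nat_approx_posE[of "e / 2"] e by auto
  \<comment> \<open>Rounding down preserves symmetry and the bounds 0 and 1.\<close>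
  define v where "v i j = of_int \<lfloor>real (Suc d) * g (real i / real (Suc m), real j / real (Suc m))\<rfloor>
      / real (Suc d)" for i j
  define W where "W p = v (part_index m (fst p)) (part_index m (snd p))" for p
  have v_sym: "v i j = v j i" for i j
    using sym unfolding v_def by metis
  have v_near: "v i j \<le> g (real i / real (Suc m), real j / real (Suc m))"
    "g (real i / real (Suc m), real j / real (Suc m)) < v i j + 1 / real (Suc d)" for i j
  proof -
    let ?t = "g (real i / real (Suc m), real j / real (Suc m))"
    have "of_int \<lfloor>real (Suc d) * ?t\<rfloor> \<le> real (Suc d) * ?t"
      "real (Suc d) * ?t < of_int \<lfloor>real (Suc d) * ?t\<rfloor> + 1" by linarith+
    then show "v i j \<le> ?t" "?t < v i j + 1 / real (Suc d)"
      unfolding v_def by (auto simp: field_simps simp del: of_nat_Suc)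
  qed
  have v_bounds: "0 \<le> v i j" "v i j \<le> 1" for i j
    using bounds v_near(1)[of i j] by (simp add: v_def) (meson bounds order_trans v_near(1))
  have meas: "W \<in> borel_measurable borel"
  proof -
    have i: "part_index m \<in> borel \<rightarrow>\<^sub>M count_space UNIV"
      unfolding part_index_def by measurable
    have 1: "(\<lambda>p::real \<times> real. part_index m (fst p)) \<in> borel \<rightarrow>\<^sub>M count_space UNIV"
      by (rule measurable_compose[OF _ i]) (simp add: borel_prod[symmetric])
    have 2: "(\<lambda>p::real \<times> real. part_index m (snd p)) \<in> borel \<rightarrow>\<^sub>M count_space UNIV"
      by (rule measurable_compose[OF _ i]) (simp add: borel_prod[symmetric])
    show ?thesis unfolding W_def
      by (rule measurable_compose_countable[OF _ 1], rule measurable_compose_countable[OF _ 2]) simp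
  qed
  have graphon: "graphon W"
    unfolding graphon_def
  proof (intro conjI ballI)
    show "W \<in> borel_measurable (lebesgue_on unit_square)"
      using meas by (intro measurable_restrict_space1) (simp add: measurable_completion)
  qed (use v_sym v_bounds in \<open>auto simp: W_def\<close>)
  have "step_graphon W"
    unfolding step_graphon_def
  proof (intro conjI graphon exI[of _ "Suc m"] allI impI)
    fix i j assume ij: "i < Suc m" "j < Suc m"
    have "v i j \<in> \<rat>" unfolding v_def by (intro Rats_divide Rats_of_int Rats_of_nat)
    then show "\<exists>q\<in>\<rat>. \<forall>x\<in>part (Suc m) i. \<forall>y\<in>part (Suc m) j. W (x, y) = q"
      using part_index_part ij by (intro bexI[of _ "v i j"]) (auto simp: W_def)
  qed simp
  moreover have "\<bar>W p - g p\<bar> \<le> e" if "p \<in> unit_square" for p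
  proof -
    obtain x y where p: "p = (x, y)" "x \<in> {0..1}" "y \<in> {0..1}"
      using \<open>p \<in> unit_square\<close> by blast
    let ?i = "part_index m x" and ?j = "part_index m y"
    have near: "real (part_index m x) / real (Suc m) \<in> {0..1} \<and>
        \<bar>x - real (part_index m x) / real (Suc m)\<bar> \<le> 1 / real (Suc m)" if "x \<in> {0..1}" for x
    proof -
      have k: "part_index m x < Suc m" by (rule part_index_less)
      have "x \<in> part (Suc m) (part_index m x)" by (rule mem_part_index[OF that])
      then have "real (part_index m x) / real (Suc m) \<le> x"
        "x \<le> real (Suc (part_index m x)) / real (Suc m)"
        using k by (auto simp: part_def split: if_splits)
      moreover have "real (Suc (part_index m x)) / real (Suc m) =
          real (part_index m x) / real (Suc m) + 1 / real (Suc m)"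
        by (simp add: add_divide_distrib)
      moreover have "0 \<le> real (part_index m x) / real (Suc m)" by simp
      ultimately show ?thesis using that unfolding atLeastAtMost_iff by linarith
    qed
    let ?q = "(real ?i / real (Suc m), real ?j / real (Suc m))"
    have "dist p ?q \<le> \<bar>x - real ?i / real (Suc m)\<bar> + \<bar>y - real ?j / real (Suc m)\<bar>"
      unfolding p dist_Pair_Pair dist_real_def
      by (rule order_trans[OF sqrt_sum_squares_le_sum_abs]) simp
    also have "\<dots> < \<delta>" using near[OF p(2)] near[OF p(3)] m by linarith
    finally have "dist (g p) (g ?q) < e / 2"
      using near[OF p(2)] near[OF p(3)] that by (intro uc) auto
    moreover have "W p = v ?i ?j" by (simp add: W_def p)
    ultimately show ?thesis
      using v_near[of ?i ?j] d unfolding dist_real_def by linarith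
  qed
  ultimately show ?thesis using that by blast
qed

text \<open>Symmetrizing an approximant evaluates it at a point and at its mirror image, so the
  exceptional null set must be mirrored too.\<close>

lemma negligible_swap:
  fixes N :: "(real \<times> real) set"
  assumes "negligible N"
  shows "negligible (prod.swap ` N)"
proof (rule negligible_differentiable_image_negligible[OF order_refl assms])
  have "linear (prod.swap :: real \<times> real \<Rightarrow> real \<times> real)"
    by (intro linearI) auto
  then show "prod.swap differentiable_on N"
    by (rule linear_imp_differentiable_on)
qed

lemma integrable_L1:
  assumes "graphon U" and "graphon W"
  shows "integrable (lebesgue_on unit_square) (\<lambda>p. U p - W p)"
  using assms by (intro Bochner_Integration.integrable_diff integrable_graphon)

text \<open>A measurable function is an almost everywhere limit of continuous ones; dominated
  convergence turns this into L1 convergence, and a continuous approximant is then replaced by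
  steps.\<close>

lemma step_graphon_dense:
  assumes U: "graphon U" and e: "e > 0"
  obtains W where "step_graphon W" and "L1_dist W U < e"
proof -
  let ?M = "lebesgue_on unit_square"
  have "(\<lambda>p. if p \<in> unit_square then U p else 0) \<in> borel_measurable lebesgue"
    using U unit_square_lmeasurable
    by (subst borel_measurable_if) (auto simp: graphon_def)
  then have "(\<lambda>p. if p \<in> unit_square then U p else 0) measurable_on unit_square"
    using unit_square_lmeasurable by (intro lebesgue_measurable_imp_measurable_on_real) auto
  then obtain N g where N: "negligible N" and g: "\<And>n. continuous_on UNIV (g n)"
    and g_lim: "\<And>p. p \<notin> N \<Longrightarrow> (\<lambda>n. g n p) \<longlonglongrightarrow>
      (if p \<in> unit_square then if p \<in> unit_square then U p else 0 else 0)"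
    unfolding measurable_on_def by blast
  have lim: "(\<lambda>n. g n p) \<longlonglongrightarrow> U p" if "p \<notin> N" "p \<in> unit_square" for p
    using g_lim[OF that(1)] that(2) by simp
  \<comment> \<open>Averaging with the mirror image and clamping to values between 0 and 1 keep
    continuity and give the symmetry and bounds of a graphon. On the unit square both operations fix
    \<open>U\<close>, so the limit is unchanged.\<close>
  define h where "h n p = max 0 (min 1 ((g n p + g n (prod.swap p)) / 2))" for n p
  have cont: "continuous_on UNIV (h n)" for n
    unfolding h_def
    by (intro continuous_intros continuous_on_compose2[OF g] continuous_on_swap) auto
  have h: "h n (x, y) = h n (y, x)" "0 \<le> h n p" "h n p \<le> 1" for n x y p
    by (auto simp: h_def add.commute)
  have h_meas: "h n \<in> borel_measurable ?M" for n
    using cont[of n] by (intro measurable_restrict_space1 measurable_completion)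
      (auto intro: borel_measurable_continuous_onI)
  have "negligible (N \<union> prod.swap ` N)" using N negligible_swap by auto
  then have "N \<union> prod.swap ` N \<in> null_sets lebesgue" by (simp add: negligible_iff_null_sets)
  then have "AE p in lebesgue. p \<notin> N \<union> prod.swap ` N" by (rule AE_not_in)
  then have AE: "AE p in ?M. p \<notin> N \<union> prod.swap ` N"
    using unit_square_lmeasurable by (subst AE_restrict_space_iff) auto
  have h_lim: "(\<lambda>n. h n p) \<longlonglongrightarrow> U p" if p: "p \<in> unit_square" "p \<notin> N \<union> prod.swap ` N" for p
  proof -
    have "U p = max 0 (min 1 ((U p + U (prod.swap p)) / 2))"
      using U p unfolding graphon_def by (cases p) auto
    moreover have "(\<lambda>n. h n p) \<longlonglongrightarrow> max 0 (min 1 ((U p + U (prod.swap p)) / 2))"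
      unfolding h_def using p
      by (intro tendsto_intros lim) (auto simp: image_iff)
    ultimately show ?thesis by simp
  qed
  have "(\<lambda>n. LINT p|?M. \<bar>h n p - U p\<bar>) \<longlonglongrightarrow> (LINT p|?M. 0)"
  proof (rule integral_dominated_convergence)
    show "integrable ?M (\<lambda>_. 1 :: real)"
      by (rule integrable_unit_square[where B = 1]) auto
    show "AE p in ?M. (\<lambda>n. \<bar>h n p - U p\<bar>) \<longlonglongrightarrow> 0"
      using AE AE_space
    proof eventually_elim
      case (elim p)
      then have "(\<lambda>n. \<bar>h n p - U p\<bar>) \<longlonglongrightarrow> \<bar>U p - U p\<bar>"
        by (intro tendsto_intros h_lim) auto
      then show ?case by simp
    qed
    show "AE p in ?M. norm \<bar>h n p - U p\<bar> \<le> 1" for n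
    proof (rule AE_I2)
      fix p assume "p \<in> space ?M"
      then have "0 \<le> U p" "U p \<le> 1" using U by (auto simp: graphon_def)
      then show "norm \<bar>h n p - U p\<bar> \<le> 1" using h(2,3)[of n p] by simp
    qed
  qed (use U h_meas in \<open>auto simp: graphon_def\<close>)
  then have "eventually (\<lambda>n. (LINT p|?M. \<bar>h n p - U p\<bar>) < e / 2) sequentially"
    using e by (intro order_tendstoD(2)[where y = 0]) auto
  then obtain n where n: "(LINT p|?M. \<bar>h n p - U p\<bar>) < e / 2"
    by (auto simp: eventually_sequentially)
  \<comment> \<open>The summand 1 makes the denominator positive without computing the area, and
    \<open>c\<close> times the area stays below \<open>e / 2\<close>.\<close>
  define c where "c = e / 2 / (1 + measure ?M unit_square)"
  have pos: "1 + measure ?M unit_square > 0" by (simp add: add_pos_nonneg)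
  have c: "c > 0" using e pos by (simp add: c_def)
  obtain W where W: "step_graphon W" "\<And>p. p \<in> unit_square \<Longrightarrow> \<bar>W p - h n p\<bar> \<le> c"
  proof (rule step_graphon_near_continuous[OF _ _ _ c])
    show "continuous_on unit_square (h n)" by (rule continuous_on_subset[OF cont]) simp
    show "h n (x, y) = h n (y, x)" for x y by (rule h(1))
    show "0 \<le> h n p \<and> h n p \<le> 1" for p using h(2,3) by simp
  qed blast
  then have gW: "graphon W" by (simp add: step_graphon_def)
  have int: "integrable ?M (\<lambda>p. \<bar>h n p - U p\<bar>)" "integrable ?M (\<lambda>_. c)"
    using integrable_unit_square[OF h_meas[of n], of 1] h(2,3) integrable_graphon[OF U]
      integrable_unit_square[of "\<lambda>_. c" c] c by auto
  have "L1_dist W U \<le> (LINT p|?M. c + \<bar>h n p - U p\<bar>)"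
    unfolding L1_dist_def L1_norm_eq
  proof (rule integral_mono)
    show "integrable ?M (\<lambda>p. \<bar>W p - U p\<bar>)"
      by (intro integrable_abs integrable_L1 U gW)
    fix p assume "p \<in> space ?M"
    then show "\<bar>W p - U p\<bar> \<le> c + \<bar>h n p - U p\<bar>" using W(2)[of p] by auto
  qed (use int in auto)
  also have "\<dots> = c * measure ?M unit_square + (LINT p|?M. \<bar>h n p - U p\<bar>)"
    using int by simp
  also have "\<dots> < c * (1 + measure ?M unit_square) + e / 2" using c n by (simp add: distrib_left)
  also have "c * (1 + measure ?M unit_square) = e / 2"
    unfolding c_def using pos by (intro nonzero_eq_divide_eq[THEN iffD1]) auto
  also have "e / 2 + e / 2 = e" by simp
  finally show ?thesis using W(1) that by blast
qed

section \<open>The L1 distance as a supremum of grid norms\<close>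

lemma grid_norm_triangle:
  assumes "integrable (lebesgue_on unit_square) F" and "integrable (lebesgue_on unit_square) G"
  shows "grid_norm n (\<lambda>p. F p - G p) \<le> grid_norm n F + grid_norm n G"
  unfolding grid_norm_def sum.distrib[symmetric] using assms
  by (intro sum_mono) (auto simp: box_integral_diff intro: abs_triangle_ineq4)

text \<open>
  The grid is chosen to refine the steps of both \<open>s\<close> and a step graphon close to \<open>U\<close>.
\<close>

lemma L1_dist_less_grid_norm:
  assumes s: "step_graphon s" and U: "graphon U" and c: "c < L1_dist s U"
  obtains n where "c < grid_norm n (\<lambda>p. s p - U p)"
proof -
  \<comment> \<open>Half of the gap, because the distance from \<open>W\<close> to \<open>U\<close>
    is lost twice: in comparing \<open>L1_dist s U\<close> with \<open>L1_dist s W\<close>, and in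
    comparing the grid norms of \<open>s - W\<close> and \<open>s - U\<close>.\<close>
  obtain W where W: "step_graphon W" "L1_dist W U < (L1_dist s U - c) / 2"
    using step_graphon_dense[OF U, of "(L1_dist s U - c) / 2"] c by auto
  have g: "graphon s" "graphon W" using s W by (auto simp: step_graphon_def)
  obtain M v where M: "M > 0" "\<And>i j x y. i < M \<Longrightarrow> j < M \<Longrightarrow> x \<in> part M i \<Longrightarrow> y \<in> part M j \<Longrightarrow> s (x, y) = v i j"
    using s unfolding step_graphon_def by metis
  obtain N w where N: "N > 0" "\<And>i j x y. i < N \<Longrightarrow> j < N \<Longrightarrow> x \<in> part N i \<Longrightarrow> y \<in> part N j \<Longrightarrow> W (x, y) = w i j"
    using W(1) unfolding step_graphon_def by metis
  have "grid_norm (M * N) (\<lambda>p. s p - W p) = L1_dist s W"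
    unfolding L1_dist_def
  proof (rule grid_norm_step[where v = "\<lambda>i j. v (i div N) (j div N) - w (i div M) (j div M)"])
    show "integrable (lebesgue_on unit_square) (\<lambda>p. s p - W p)" by (intro integrable_L1 g)
    show "M * N > 0" using M N by simp
    fix i j x y assume *: "i < M * N" "j < M * N" "x \<in> part (M * N) i" "y \<in> part (M * N) j"
    then have "x \<in> part M (i div N)" "y \<in> part M (j div N)" "x \<in> part N (i div M)" "y \<in> part N (j div M)"
      using part_mult[of i M N] part_mult[of j M N] part_mult[of i N M] part_mult[of j N M]
      by (auto simp: mult.commute)
    moreover have "i div N < M" "j div N < M" "i div M < N" "j div M < N"
      using * by (auto simp: less_mult_imp_div_less mult.commute)
    ultimately show "s (x, y) - W (x, y) = v (i div N) (j div N) - w (i div M) (j div M)"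
      using M(2) N(2) by metis
  qed
  moreover have "grid_norm (M * N) (\<lambda>p. (s p - U p) - (W p - U p)) \<le>
      grid_norm (M * N) (\<lambda>p. s p - U p) + grid_norm (M * N) (\<lambda>p. W p - U p)"
    by (intro grid_norm_triangle integrable_L1 g U)
  moreover have "grid_norm (M * N) (\<lambda>p. W p - U p) \<le> L1_dist W U"
    unfolding L1_dist_def by (intro grid_norm_le_L1_norm integrable_L1 g U)
  moreover have "L1_dist s U \<le> L1_dist s W + L1_dist W U"
    by (intro L1_dist_triangle g U)
  ultimately have "c < grid_norm (M * N) (\<lambda>p. s p - U p)"
    using W(2) by simp
  then show ?thesis by (rule that)
qed

section \<open>Lower bounds for the L1 distance read off a name\<close>

text \<open>A name gives explicit bounds between its own terms only; letting the later term tend to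
  \<open>U\<close> yields one for \<open>U\<close>. Since box integrals are additive, no triangle
  inequality for the cut norm is involved.\<close>

lemma box_integral_name:
  assumes name: "is_name cut_dist s U k" and s: "\<And>i. graphon (s i)" and U: "graphon U"
    and ij: "i < n" "j < n"
  shows "\<bar>box_integral n i j (\<lambda>p. s (k m) p - U p)\<bar> \<le> 1 / 2 ^ m"
proof (rule LIMSEQ_le_const)
  show "(\<lambda>l. 1 / 2 ^ m + cut_dist (s (k l)) U) \<longlonglongrightarrow> 1 / 2 ^ m"
    using tendsto_add[OF tendsto_const[of "1 / 2 ^ m"], of "\<lambda>l. cut_dist (s (k l)) U" 0] name
    unfolding is_name_def by simp
  show "\<exists>N. \<forall>l\<ge>N. \<bar>box_integral n i j (\<lambda>p. s (k m) p - U p)\<bar> \<le> 1 / 2 ^ m + cut_dist (s (k l)) U"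
  proof (intro exI allI impI)
    fix l assume "Suc m \<le> l"
    then have "cut_dist (s (k m)) (s (k l)) \<le> 1 / 2 ^ m"
      using name unfolding is_name_def by auto
    moreover have "box_integral n i j (\<lambda>p. s (k m) p - U p) =
        box_integral n i j (\<lambda>p. s (k m) p - s (k l) p) + box_integral n i j (\<lambda>p. s (k l) p - U p)"
      using s U by (simp add: box_integral_diff[OF ij] integrable_graphon)
    ultimately show "\<bar>box_integral n i j (\<lambda>p. s (k m) p - U p)\<bar> \<le> 1 / 2 ^ m + cut_dist (s (k l)) U"
      using abs_box_integral_le_cut_dist[OF s[of "k m"] s[of "k l"] ij]
        abs_box_integral_le_cut_dist[OF s[of "k l"] U ij] by linarith
  qed
qed

text \<open>One error for each box: the bound worsens as the grid is refined, so \<open>m\<close>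
  has to be chosen after \<open>n\<close>.\<close>

lemma grid_norm_name:
  assumes "is_name cut_dist s U k" and "\<And>i. graphon (s i)" and "graphon U"
  shows "grid_norm n (\<lambda>p. s (k m) p - U p) \<le> real (n * n) / 2 ^ m"
proof -
  have "grid_norm n (\<lambda>p. s (k m) p - U p) \<le> (\<Sum>i<n. \<Sum>j<n. 1 / 2 ^ m)"
    unfolding grid_norm_def using assms by (intro sum_mono box_integral_name) auto
  then show ?thesis by simp
qed

text \<open>The right-hand side mentions step graphons only, so each pair \<open>n\<close>,
  \<open>m\<close> can be tested with exact rationals. The added term absorbs the error of replacing
  \<open>U\<close> by \<open>s (k m)\<close>, so every successful test is a proof.\<close>

lemma less_L1_dist_iff:
  assumes name: "is_name cut_dist s U k" and s: "\<And>i. step_graphon (s i)" and U: "graphon U"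
  shows "c < L1_dist (s i) U \<longleftrightarrow>
    (\<exists>n m. c + real (n * n) / 2 ^ m < grid_norm n (\<lambda>p. s i p - s (k m) p))"
proof
  have g: "graphon (s i)" for i using s by (simp add: step_graphon_def)
  note I = integrable_L1[OF g U] integrable_L1[OF g g]
  assume "c < L1_dist (s i) U"
  then obtain n where n: "c < grid_norm n (\<lambda>p. s i p - U p)"
    using L1_dist_less_grid_norm[OF s U] by blast
  \<comment> \<open>The error term must fit into the gap twice: once in the claim and once for
    exchanging \<open>U\<close> with \<open>s (k m)\<close>. The \<open>+ 1\<close> keeps the
    denominator positive for \<open>n = 0\<close>.\<close>
  define b where "b = (grid_norm n (\<lambda>p. s i p - U p) - c) / (2 * (real (n * n) + 1))"
  have "b > 0" using n by (simp add: b_def add_nonneg_pos)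
  then obtain m where "(1 / 2) ^ m < b" using real_arch_pow_inv[of b "1 / 2"] by auto
  then have "2 * (real (n * n) + 1) * (1 / 2 ^ m) < grid_norm n (\<lambda>p. s i p - U p) - c"
    unfolding b_def by (simp add: power_one_over pos_less_divide_eq add_nonneg_pos mult.commute)
  moreover have "2 * (real (n * n) + 1) * (1 / 2 ^ m) = 2 * (real (n * n) / 2 ^ m) + 2 * (1 / 2 ^ m)"
    by (simp add: algebra_simps add_divide_distrib)
  moreover have "(0::real) < 1 / 2 ^ m" by simp
  ultimately have "c + 2 * (real (n * n) / 2 ^ m) < grid_norm n (\<lambda>p. s i p - U p)" by linarith
  moreover have "grid_norm n (\<lambda>p. s i p - U p) =
      grid_norm n (\<lambda>p. (s i p - s (k m) p) - (U p - s (k m) p))" by simp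
  moreover have "\<dots> \<le> grid_norm n (\<lambda>p. s i p - s (k m) p) + grid_norm n (\<lambda>p. U p - s (k m) p)"
    by (intro grid_norm_triangle integrable_L1 g U)
  moreover have "grid_norm n (\<lambda>p. U p - s (k m) p) = grid_norm n (\<lambda>p. s (k m) p - U p)"
    unfolding grid_norm_def using g U
    by (intro sum.cong) (auto simp: box_integral_diff integrable_graphon abs_minus_commute)
  moreover have "\<dots> \<le> real (n * n) / 2 ^ m" by (rule grid_norm_name[OF name g U])
  ultimately have "c + real (n * n) / 2 ^ m < grid_norm n (\<lambda>p. s i p - s (k m) p)" by linarith
  then show "\<exists>n m. c + real (n * n) / 2 ^ m < grid_norm n (\<lambda>p. s i p - s (k m) p)" by blast
next
  have g: "graphon (s i)" for i using s by (simp add: step_graphon_def)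
  assume "\<exists>n m. c + real (n * n) / 2 ^ m < grid_norm n (\<lambda>p. s i p - s (k m) p)"
  then obtain n m where "c + real (n * n) / 2 ^ m < grid_norm n (\<lambda>p. s i p - s (k m) p)" by blast
  moreover have "grid_norm n (\<lambda>p. s i p - s (k m) p) =
      grid_norm n (\<lambda>p. (s i p - U p) - (s (k m) p - U p))" by simp
  moreover have "\<dots> \<le> grid_norm n (\<lambda>p. s i p - U p) + grid_norm n (\<lambda>p. s (k m) p - U p)"
    by (intro grid_norm_triangle integrable_L1 g U)
  moreover have "grid_norm n (\<lambda>p. s (k m) p - U p) \<le> real (n * n) / 2 ^ m"
    by (rule grid_norm_name[OF name g U])
  moreover have "grid_norm n (\<lambda>p. s i p - U p) \<le> L1_dist (s i) U"
    unfolding L1_dist_def by (intro grid_norm_le_L1_norm integrable_L1 g U)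
  ultimately show "c < L1_dist (s i) U" by linarith
qed

section \<open>The L1 name\<close>

lemma grid_norm_enumeration:
  assumes N: "\<And>k. N k > 0"
    and val: "\<And>k i j x y. i < N k \<Longrightarrow> j < N k \<Longrightarrow> x \<in> part (N k) i \<Longrightarrow> y \<in> part (N k) j \<Longrightarrow>
      s k (x, y) = real (a (cpair k (cpair i j))) / real (Suc (b (cpair k (cpair i j))))"
    and "computable_from f N" "computable_from f a" "computable_from f b"
    and int: "\<And>k. integrable (lebesgue_on unit_square) (s k)"
    and "computable_from f n" "computable_from f k" "computable_from f l"
  shows "rat_computable_from f (\<lambda>x. grid_norm (n x) (\<lambda>p. s (k x) p - s (l x) p))"
proof -
  \<comment> \<open>The box integral as a finite sum of rationals in the data of the enumeration;
    its computability can then be read off its syntax.\<close>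
  define B where "B n p q e = (\<Sum>i<N e. \<Sum>j<N e.
      real (a (cpair e (cpair i j))) / real (Suc (b (cpair e (cpair i j)))) *
      (real (min (Suc p * N e) (Suc i * n) - max (p * N e) (i * n)) / real (n * N e) *
       (real (min (Suc q * N e) (Suc j * n) - max (q * N e) (j * n)) / real (n * N e))))" for n p q e
  have B: "box_integral n p q (s e) = B n p q e" if "p < n" "q < n" for n p q e
  proof -
    have "box_integral n p q (s e) = (\<Sum>i<N e. \<Sum>j<N e.
        real (a (cpair e (cpair i j))) / real (Suc (b (cpair e (cpair i j)))) *
        (measure lborel (part n p \<inter> part (N e) i) * measure lborel (part n q \<inter> part (N e) j)))"
      by (rule box_integral_step[OF N _ that]) (rule val)
    also have "\<dots> = B n p q e"
      unfolding B_def using that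
      by (intro sum.cong refl arg_cong2[where f = "(*)"] measure_part_Int) auto
    finally show ?thesis .
  qed
  have "grid_norm n (\<lambda>p. s k p - s l p) = (\<Sum>p<n. \<Sum>q<n. \<bar>B n p q k - B n p q l\<bar>)" for n k l
    unfolding grid_norm_def using int by (intro sum.cong) (auto simp: box_integral_diff B)
  moreover have "rat_computable_from f (\<lambda>x. \<Sum>p<n x. \<Sum>q<n x. \<bar>B (n x) p q (k x) - B (n x) p q (l x)\<bar>)"
    unfolding B_def
    by (intro rat_computable_from_sum rat_computable_from_abs rat_computable_from_diff
      rat_computable_from_mult rat_computable_from_divide_nat rat_computable_from_of_nat
      assms(3-5,7-9)[THEN computable_from_comp]
      computable_from_fst[THEN computable_from_comp] computable_from_snd[THEN computable_from_comp]
      computable_from_id computable_from_pair computable_from_diff computable_from_min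
      computable_from_max computable_from_mult computable_from_Suc)
  ultimately show ?thesis by simp
qed

lemma ex_L1_name:
  assumes s: "computable_enumeration s" and U: "graphon U"
    and name: "is_name cut_dist s U k" and k: "computable_from f k"
  shows "\<exists>l. is_name L1_dist s U l \<and> computable_from (indicator (jump f)) l"
proof -
  have step: "step_graphon (s i)" for i
    using s by (simp add: computable_enumeration_def)
  then have graphon: "graphon (s i)" for i by (simp add: step_graphon_def)
  obtain N a b where comp: "computable N" "computable a" "computable b"
    and steps: "\<forall>k. N k > 0 \<and> (\<forall>i<N k. \<forall>j<N k. \<forall>x\<in>part (N k) i. \<forall>y\<in>part (N k) j.
      s k (x, y) = real (a (cpair k (cpair i j))) / real (Suc (b (cpair k (cpair i j)))))"
    using s unfolding computable_enumeration_def by (elim conjE exE)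
  have N: "N k > 0" for k using steps by simp
  have val: "s k (x, y) = real (a (cpair k (cpair i j))) / real (Suc (b (cpair k (cpair i j))))"
    if "i < N k" "j < N k" "x \<in> part (N k) i" "y \<in> part (N k) j" for k i j x y
    by (rule steps[THEN spec, THEN conjunct2, rule_format, OF that])
  let ?F = "\<lambda>z. fst (prod_decode z)" and ?S = "\<lambda>z. snd (prod_decode z)"
  \<comment> \<open>\<open>z\<close> codes \<open>((j, i), (n, m))\<close>, and
    \<open>g z = 0\<close> says that the grid \<open>n\<close> and the term \<open>m\<close> of the
    name witness \<open>1 / 2 ^ Suc j < L1_dist (s i) U\<close>. Constants are written as quotients
    of naturals to match the rules for \<open>rat_computable_from\<close>.\<close>
  define g where "g z = (of_bool (grid_norm (?F (?S z)) (\<lambda>p. s (?S (?F z)) p - s (k (?S (?S z))) p) \<le>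
      real 1 / real (2 ^ Suc (?F (?F z))) + real (?F (?S z) * ?F (?S z)) / real (2 ^ ?S (?S z))) :: nat)"
    for z
  note I = computable_from_fst[THEN computable_from_comp] computable_from_snd[THEN computable_from_comp]
    computable_from_id computable_from_const computable_from_mult computable_from_power
    computable_from_Suc k[THEN computable_from_comp]
  have "rat_computable_from f (\<lambda>z. grid_norm (?F (?S z)) (\<lambda>p. s (?S (?F z)) p - s (k (?S (?S z))) p))"
  proof (rule grid_norm_enumeration)
    show "N k > 0" for k by (rule N)
    show "s k (x, y) = real (a (cpair k (cpair i j))) / real (Suc (b (cpair k (cpair i j))))"
      if "i < N k" "j < N k" "x \<in> part (N k) i" "y \<in> part (N k) j" for k i j x y
      using that by (rule val)
  qed (intro comp[THEN computable_imp_computable_from] integrable_graphon graphon I)+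
  then have "computable_from f g"
    unfolding g_def
    by (intro computable_from_rat_le rat_computable_from_add rat_computable_from_divide_nat
      rat_computable_from_of_nat I)
  then have "computable_from (indicator (jump f)) (\<lambda>x. of_bool (\<exists>n. g (cpair x n) = 0))"
    by (rule computable_from_jump)
  moreover have "(\<exists>w. g (cpair x w) = 0) \<longleftrightarrow> 1 / 2 ^ Suc (?F x) < L1_dist (s (?S x)) U" for x
  proof -
    have "(\<exists>w. g (cpair x w) = 0) \<longleftrightarrow> (\<exists>n m. g (cpair x (cpair n m)) = 0)"
    proof
      assume "\<exists>w. g (cpair x w) = 0"
      then obtain w where "g (cpair x (cpair (?F w) (?S w))) = 0" by auto
      then show "\<exists>n m. g (cpair x (cpair n m)) = 0" by blast
    qed blast
    then show ?thesis
      by (simp add: less_L1_dist_iff[OF name step U] g_def not_le)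
  qed
  ultimately have dec: "computable_from (indicator (jump f))
      (\<lambda>x. of_bool (1 / 2 ^ Suc (?F x) < L1_dist (s (?S x)) U))" by simp
  have ex: "\<exists>i. L1_dist (s i) U \<le> 1 / 2 ^ Suc j" for j
  proof -
    obtain W where W: "step_graphon W" "L1_dist W U < 1 / 2 ^ Suc j"
      using step_graphon_dense[OF U, of "1 / 2 ^ Suc j"] by auto
    have "\<forall>W. step_graphon W \<longrightarrow> (\<exists>i. \<forall>p\<in>unit_square. s i p = W p)"
      using s unfolding computable_enumeration_def by (elim conjE)
    then obtain i where i: "\<And>p. p \<in> unit_square \<Longrightarrow> s i p = W p" using W(1) by blast
    have "L1_dist (s i) U = L1_dist W U"
      unfolding L1_dist_def L1_norm_eq by (intro Bochner_Integration.integral_cong) (simp_all add: i)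
    then show ?thesis using W(2) by (intro exI[of _ i]) simp
  qed
  \<comment> \<open>The exponent is \<open>Suc j\<close> because a triangle through \<open>U\<close>
    adds the errors of two terms, which must stay within the bound for the earlier one.\<close>
  define l where "l j = (LEAST i. L1_dist (s i) U \<le> 1 / 2 ^ Suc j)" for j
  have l: "L1_dist (s (l j)) U \<le> 1 / 2 ^ Suc j" for j
    unfolding l_def by (rule LeastI_ex[OF ex])
  have "computable_from (indicator (jump f)) l"
    \<comment> \<open>A zero of the decided test means that the strict inequality fails, which is
      the condition in \<open>l\<close>; density guarantees that the search ends.\<close>
    using computable_from_Least[OF dec] ex by (simp add: l_def[abs_def] not_less)
  moreover have "is_name L1_dist s U l"
    unfolding is_name_def
  proof (intro conjI allI impI)
    fix i j :: nat assume "i < j"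
    then have "(1::real) / 2 ^ Suc j \<le> 1 / 2 ^ Suc i"
      by (intro divide_left_mono power_increasing) auto
    then show "L1_dist (s (l i)) (s (l j)) \<le> 1 / 2 ^ i"
      using L1_dist_triangle[OF graphon U graphon, of "l i" "l j"] l[of i] l[of j]
      by (simp add: L1_dist_commute[of U])
  next
    have "(\<lambda>j. 1 / 2 ^ Suc j :: real) \<longlonglongrightarrow> 0"
      using LIMSEQ_Suc[OF LIMSEQ_inverse_realpow_zero[of 2]] by (simp add: inverse_eq_divide)
    then show "(\<lambda>j. L1_dist (s (l j)) U) \<longlonglongrightarrow> 0"
      by (rule Lim_null_comparison[rotated]) (use l L1_dist_nonneg in auto)
  qed
  ultimately show ?thesis by blast
qed

theorem theorem4p4:
  fixes s :: "nat \<Rightarrow> real \<times> real \<Rightarrow> real" and U :: "real \<times> real \<Rightarrow> real"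
  assumes "computable_enumeration s" and "graphon U"
  shows "(\<forall>k. is_name cut_dist s U k \<longrightarrow>
            (\<exists>l. is_name L1_dist s U l \<and> computable_from (indicator (jump k)) l)) \<and>
         ((\<exists>k. is_name cut_dist s U k \<and> computable k) \<longrightarrow>
            (\<exists>l. is_name L1_dist s U l \<and> computable_from (indicator halting_set) l))"
proof -
  \<comment> \<open>The first claim uses the name as its own oracle; the second uses the empty
    oracle, whose jump is the halting set.\<close>
  have "computable_from k k" for k
    unfolding computable_from_def using evaluates.Query by blast
  then show ?thesis
    using ex_L1_name[OF assms] unfolding halting_set_def computable_def by blast
qed

end
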